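(* Let $\Omega \subset \mathbb{R}^2$ be a bounded convex domain, let $\mathcal{O}$ be an opaque set for $\Omega$ of length $L$, and let $\mu_{\mathcal{O}}$ and $\mu_{\partial \Omega}$ be the associated angular orientation measures. Then $$ \left\| \mu_{\mathcal{O}} - \mu_{\partial \Omega} \right\|_{\dot H^{-2}(\mathbb{T})} \leq \frac{L^{1/4}}{\sqrt{2}} \cdot \left(L - \frac{|\partial \Omega|}{2}\right)^{3/4}.$$
   Context: A set $\mathcal{O}\subset\mathbb{R}^2$ is an opaque set for $\Omega$ if every line in $\mathbb{R}^2$ that intersects $\Omega$ also intersects $\mathcal{O}$. Here a bounded convex domain is a bounded convex set with nonempty interior, and $|\partial\Omega|$ is the length of its boundary. Opaque sets are assumed to be given as a countable union of line segments $\ell_i$ (overlapping only in sets of zero $\mathcal{H}^1$-measure) of lengths $|\ell_i|$, with finite total length $L=\sum_i|\ell_i|=\mathcal{H}^1(\mathcal{O})$. Angular measures on $[0,2\pi)\cong\mathbb{T}$ (angles modulo $2\pi$): if the segment $\ell_i$ makes angle $\alpha_i$ with the $x$-axis (counterclockwise), then $$\mu_{\mathcal{O}}=\sum_i \frac{|\ell_i|}{2}\left(\delta_{\alpha_i}+\delta_{\alpha_i+\pi}\right),$$ which has total mass $L$. The measure $\mu_{\partial\Omega}$ is obtained by the same construction applied to $\partial\Omega$ and then multiplied by $1/2$: if $\gamma:[0,|\partial\Omega|]\to\partial\Omega$ is an arclength parametrization of the boundary and $\tau(s)$ is the angle of the tangent $\gamma'(s)$ with the $x$-axis (defined for almost every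 $s$), then for every continuous $2\pi$-periodic $\phi$, $$\int_0^{2\pi} \phi\, d\mu_{\partial\Omega}=\frac14\int_0^{|\partial\Omega|}\left(\phi(\tau(s))+\phi(\tau(s)+\pi)\right)ds,$$ so that $\mu_{\partial\Omega}$ has total mass $|\partial\Omega|/2$. For a finite signed measure $\nu$ on $\mathbb{T}$, $$\|\nu\|_{\dot H^{-2}(\mathbb{T})}^2:=\sum_{\ell\in\mathbb{Z},\ \ell\neq0}\frac{|\widehat{\nu}(\ell)|^2}{\ell^4},\qquad \widehat{\nu}(\ell)=\frac{1}{\sqrt{2\pi}}\int_0^{2\pi}e^{-i\ell\theta}\,d\nu(\theta).$$ By the classical inequality of Jones, $L\ge|\partial\Omega|/2$, so the right-hand side of the claim is well defined. *)

theory Defs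
  imports "HOL-Analysis.Analysis" "HOL-Library.Real_Mod"
begin

text \<open>One-dimensional Hausdorff outer measure. Boundedness of the covering sets is required because
  \<open>diameter\<close> is unspecified on unbounded sets.\<close>

definition hausdorff1_pre :: "real \<Rightarrow> 'a::metric_space set \<Rightarrow> ennreal" where
  "hausdorff1_pre \<delta> A =
     (INF C \<in> {C :: nat \<Rightarrow> 'a set. A \<subseteq> (\<Union>n. C n) \<and> (\<forall>n. bounded (C n) \<and> diameter (C n) \<le> \<delta>)}.
        \<Sum>n. ennreal (diameter (C n)))"

definition hausdorff1 :: "'a::metric_space set \<Rightarrow> ennreal" where
  "hausdorff1 A = (SUP \<delta> \<in> {0<..}. hausdorff1_pre \<delta> A)"

definition boundary_length :: "(real^2) set \<Rightarrow> real" where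
  "boundary_length \<Omega> = enn2real (hausdorff1 (frontier \<Omega>))"

definition opaque_set :: "(real^2) set \<Rightarrow> (real^2) set \<Rightarrow> bool" where
  "opaque_set \<O> \<Omega> \<longleftrightarrow>
     (\<forall>l. affine l \<and> aff_dim l = 1 \<and> l \<inter> \<Omega> \<noteq> {} \<longrightarrow> l \<inter> \<O> \<noteq> {})"

text \<open>The index set \<open>I\<close> may be finite or infinite. Segments are nondegenerate, so that each has
  a direction.\<close>

definition segment_union ::
    "(real^2) set \<Rightarrow> nat set \<Rightarrow> (nat \<Rightarrow> real^2) \<Rightarrow> (nat \<Rightarrow> real^2) \<Rightarrow> bool" where
  "segment_union \<O> I a b \<longleftrightarrow>
     \<O> = (\<Union>i\<in>I. closed_segment (a i) (b i)) \<and>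
     (\<forall>i\<in>I. a i \<noteq> b i) \<and>
     (\<forall>i\<in>I. \<forall>j\<in>I. i \<noteq> j \<longrightarrow>
        hausdorff1 (closed_segment (a i) (b i) \<inter> closed_segment (a j) (b j)) = 0) \<and>
     (\<lambda>i. dist (a i) (b i)) summable_on I"

definition total_length :: "nat set \<Rightarrow> (nat \<Rightarrow> real^2) \<Rightarrow> (nat \<Rightarrow> real^2) \<Rightarrow> real" where
  "total_length I a b = (\<Sum>\<^sub>\<infinity>i\<in>I. dist (a i) (b i))"

definition angle_of :: "real^2 \<Rightarrow> real" where
  "angle_of v = Arg2pi (Complex (v $ 1) (v $ 2))"

definition circle_borel :: "real measure" where
  "circle_borel = restrict_space borel {0..<2*pi}"

text \<open>For a weight measure \<open>W\<close> and an angle function \<open>\<tau>\<close> this is the measure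
  \<open>\<integral> (\<delta>\<^bsub>\<tau>(x)\<^esub> + \<delta>\<^bsub>\<tau>(x)+\<pi>\<^esub>) dW(x)\<close> on \<open>[0,2\<pi>)\<close>, angles being reduced modulo \<open>2\<pi>\<close>;
  see \<open>emeasure_symm_angular\<close>, \<open>emeasure_segments_orientation\<close> and \<open>integral_boundary_orientation\<close> below.\<close>

definition symm_angular :: "'i measure \<Rightarrow> ('i \<Rightarrow> real) \<Rightarrow> real measure" where
  "symm_angular W \<tau> =
     distr (W \<Otimes>\<^sub>M count_space {0, pi}) circle_borel (\<lambda>(x, t). (\<tau> x + t) rmod (2*pi))"

definition segments_orientation ::
    "nat set \<Rightarrow> (nat \<Rightarrow> real^2) \<Rightarrow> (nat \<Rightarrow> real^2) \<Rightarrow> real measure" where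
  "segments_orientation I a b =
     symm_angular (density (count_space I) (\<lambda>i. ennreal (dist (a i) (b i) / 2)))
       (\<lambda>i. angle_of (b i - a i))"

text \<open>Arclength parametrization of the boundary as a simple closed curve, started anywhere and
  traversed in either direction (which does not affect the symmetrized orientation measure). For a
  Lipschitz map, unit speed almost everywhere means that the restriction to any \<open>[s,t]\<close> has
  length \<open>t - s\<close>.\<close>

definition arclength_boundary :: "(real^2) set \<Rightarrow> (real \<Rightarrow> real^2) \<Rightarrow> bool" where
  "arclength_boundary \<Omega> \<gamma> \<longleftrightarrow>
     (let P = boundary_length \<Omega> in
       \<gamma> ` {0..P} = frontier \<Omega> \<and> \<gamma> 0 = \<gamma> P \<and> inj_on \<gamma> {0..<P} \<and>
       1-lipschitz_on {0..P} \<gamma> \<and>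
       (AE s in lebesgue_on {0..P}.
          \<gamma> differentiable (at s) \<and> norm (vector_derivative \<gamma> (at s)) = 1))"

definition tangent_angle :: "(real \<Rightarrow> real^2) \<Rightarrow> real \<Rightarrow> real" where
  "tangent_angle \<gamma> s = angle_of (vector_derivative \<gamma> (at s))"

definition boundary_orientation :: "(real^2) set \<Rightarrow> (real \<Rightarrow> real^2) \<Rightarrow> real measure" where
  "boundary_orientation \<Omega> \<gamma> =
     symm_angular (density (lebesgue_on {0..boundary_length \<Omega>}) (\<lambda>_. ennreal (1/4)))
       (tangent_angle \<gamma>)"

definition fourier_coeff :: "real measure \<Rightarrow> int \<Rightarrow> complex" where
  "fourier_coeff M l =
     of_real (1 / sqrt (2*pi)) * (\<integral>\<theta>. exp (- \<i> * of_int l * of_real \<theta>) \<partial>M)"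

text \<open>A finite signed measure \<open>\<nu> = M - N\<close> is represented by the two finite measures \<open>M\<close>, \<open>N\<close>; its
  Fourier coefficients are the differences of theirs.\<close>

definition Hdot_minus2_norm_diff :: "real measure \<Rightarrow> real measure \<Rightarrow> real" where
  "Hdot_minus2_norm_diff M N =
     sqrt (\<Sum>\<^sub>\<infinity>l\<in>-{0}. (cmod (fourier_coeff M l - fourier_coeff N l))\<^sup>2 / (of_int l) ^ 4)"


lemma space_circle_borel: "space circle_borel = {0..<2*pi}"
  by (simp add: circle_borel_def space_restrict_space)

lemma measurable_rmod_circle: "(\<lambda>x. x rmod (2*pi)) \<in> borel \<rightarrow>\<^sub>M circle_borel"
  unfolding circle_borel_def rmod_def
  apply (rule measurable_restrict_space2)
  subgoal using rmod_nonneg[of "2*pi"] rmod_less[of "2*pi"] by (auto simp: rmod_def)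
  subgoal by measurable
  done

lemma measurable_symm_angular:
  assumes "\<tau> \<in> borel_measurable W"
  shows "(\<lambda>(x, t). (\<tau> x + t) rmod (2*pi)) \<in> (W \<Otimes>\<^sub>M count_space {0, pi}) \<rightarrow>\<^sub>M circle_borel"
proof -
  have [measurable]: "\<tau> \<in> borel_measurable W" by fact
  have [measurable]: "(\<lambda>t::real. t) \<in> count_space {0, pi} \<rightarrow>\<^sub>M borel" by simp
  have "(\<lambda>p. \<tau> (fst p) + snd p) \<in> borel_measurable (W \<Otimes>\<^sub>M count_space {0, pi})"
    by measurable
  from measurable_compose[OF this measurable_rmod_circle] show ?thesis
    by (simp add: case_prod_beta)
qed

lemma nn_integral_symm_angular:
  assumes t: "\<tau> \<in> borel_measurable W" and s: "sigma_finite_measure W"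
    and f: "f \<in> borel_measurable circle_borel"
  shows "(\<integral>\<^sup>+\<theta>. f \<theta> \<partial>symm_angular W \<tau>) =
    (\<integral>\<^sup>+x. f (\<tau> x rmod (2*pi)) + f ((\<tau> x + pi) rmod (2*pi)) \<partial>W)"
proof -
  have "pi \<noteq> 0" by simp
  interpret C: sigma_finite_measure "count_space {0, pi}"
    by (rule sigma_finite_measure_count_space_finite) simp
  note m = measurable_symm_angular[OF t]
  have "(\<integral>\<^sup>+\<theta>. f \<theta> \<partial>symm_angular W \<tau>) =
     (\<integral>\<^sup>+p. f (case p of (x, t) \<Rightarrow> (\<tau> x + t) rmod (2*pi)) \<partial>(W \<Otimes>\<^sub>M count_space {0, pi}))"
    unfolding symm_angular_def by (rule nn_integral_distr[OF m]) (simp add: f)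
  also have "\<dots> = (\<integral>\<^sup>+x. \<integral>\<^sup>+t. f ((\<tau> x + t) rmod (2*pi)) \<partial>count_space {0, pi} \<partial>W)"
    using C.nn_integral_fst[OF measurable_compose[OF m f]] by simp
  finally show ?thesis
    using \<open>pi \<noteq> 0\<close> by (simp add: nn_integral_count_space_finite add.commute)
qed

lemma emeasure_symm_angular:
  assumes t: "\<tau> \<in> borel_measurable W" and s: "sigma_finite_measure W"
    and A: "A \<in> sets circle_borel"
  shows "emeasure (symm_angular W \<tau>) A =
    (\<integral>\<^sup>+x. indicator A (\<tau> x rmod (2*pi)) + indicator A ((\<tau> x + pi) rmod (2*pi)) \<partial>W)"
  using nn_integral_symm_angular[OF t s, of "indicator A"] A
  by (simp add: symm_angular_def)

lemma integral_symm_angular: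
  fixes f :: "real \<Rightarrow> 'b::euclidean_space"
  assumes t: "\<tau> \<in> borel_measurable W" and W: "finite_measure W"
    and f: "continuous_on UNIV f" and per: "\<And>x. f (x + 2*pi) = f x"
  shows "(\<integral>\<theta>. f \<theta> \<partial>symm_angular W \<tau>) = (\<integral>x. f (\<tau> x) + f (\<tau> x + pi) \<partial>W)"
proof -
  have "pi \<noteq> 0" by simp
  interpret W: finite_measure W by fact
  interpret C: finite_measure "count_space {0, pi}"
    by (rule finite_measure_count_space) simp
  interpret P: pair_sigma_finite W "count_space {0, pi}" ..
  note m = measurable_symm_angular[OF t]
  have [measurable]: "\<tau> \<in> borel_measurable W" by fact
  have fb[measurable]: "f \<in> borel_measurable borel"
    using f by (rule borel_measurable_continuous_onI)
  have fc: "f \<in> borel_measurable circle_borel"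
    unfolding circle_borel_def by (rule measurable_restrict_space1) (fact fb)
  have pern: "f (x + 2*pi * real n) = f x" for x n
  proof (induction n)
    case (Suc n)
    have "f (x + 2*pi * real (Suc n)) = f ((x + 2*pi * real n) + 2*pi)"
      by (simp add: algebra_simps)
    then show ?case using Suc per by metis
  qed simp
  have peri: "f (x + 2*pi * of_int k) = f x" for x k
  proof (cases "k \<ge> 0")
    case True then show ?thesis using pern[of x "nat k"] by simp
  next
    case False then show ?thesis using pern[of "x + 2*pi * of_int k" "nat (-k)"]
      by (simp add: algebra_simps)
  qed
  have rm: "f (x rmod (2*pi)) = f x" for x
    using peri[of x "- \<lfloor>x / (2*pi)\<rfloor>"] by (simp add: rmod_def algebra_simps)
  have "compact (f ` {0..2*pi})"
    by (intro compact_continuous_image continuous_on_subset[OF f]) auto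
  then obtain B where B: "\<And>x. x \<in> {0..2*pi} \<Longrightarrow> norm (f x) \<le> B"
    by (meson bounded_iff compact_imp_bounded imageI)
  have Bf: "norm (f x) \<le> B" for x
    using B[of "x rmod (2*pi)"] rmod_nonneg[of "2*pi" x] rmod_le[of "2*pi" x] rm[of x] by simp
  have fin: "finite_measure (W \<Otimes>\<^sub>M count_space {0, pi})"
    by (rule finite_measure_pair_measure) unfold_locales
  have int: "integrable (W \<Otimes>\<^sub>M count_space {0, pi})
      (\<lambda>p. f (case p of (x, t) \<Rightarrow> (\<tau> x + t) rmod (2*pi)))"
    by (rule finite_measure.integrable_const_bound[OF fin, where B = B])
       (use Bf measurable_compose[OF m fc] in auto)
  have "(\<integral>\<theta>. f \<theta> \<partial>symm_angular W \<tau>) =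
     (\<integral>p. f (case p of (x, t) \<Rightarrow> (\<tau> x + t) rmod (2*pi)) \<partial>(W \<Otimes>\<^sub>M count_space {0, pi}))"
    unfolding symm_angular_def by (rule integral_distr[OF m fc])
  also have "\<dots> = (\<integral>x. \<integral>t. f ((\<tau> x + t) rmod (2*pi)) \<partial>count_space {0, pi} \<partial>W)"
    using P.integral_fst'[OF int] by simp
  finally show ?thesis
    using \<open>pi \<noteq> 0\<close> by (simp add: rm lebesgue_integral_count_space_finite add.commute)
qed

lemma angle_of_rmod: "angle_of v rmod (2*pi) = angle_of v"
  unfolding angle_of_def using Arg2pi by (intro rmod_idem) auto

lemma emeasure_segments_orientation:
  assumes A: "A \<in> sets circle_borel"
  shows "emeasure (segments_orientation I a b) A =
    (\<integral>\<^sup>+i. ennreal (dist (a i) (b i) / 2) *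
       (indicator A (angle_of (b i - a i)) + indicator A ((angle_of (b i - a i) + pi) rmod (2*pi)))
     \<partial>count_space I)"
proof -
  define W where "W = density (count_space I) (\<lambda>i. ennreal (dist (a i) (b i) / 2))"
  have "sigma_finite_measure (count_space I)"
    by (rule sigma_finite_measure_count_space_countable) simp
  then have s: "sigma_finite_measure W"
    unfolding W_def by (subst sigma_finite_measure.sigma_finite_iff_density_finite) auto
  have t: "(\<lambda>i. angle_of (b i - a i)) \<in> borel_measurable W" unfolding W_def by simp
  show ?thesis
    unfolding segments_orientation_def W_def[symmetric] emeasure_symm_angular[OF t s A] angle_of_rmod
    unfolding W_def by (subst nn_integral_density) auto
qed

lemma borel_measurable_angle_of: "angle_of \<in> borel_measurable borel"
proof -
  have "Arg2pi \<in> borel_measurable borel"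
    using closed_Arg2pi2pi_le by (intro borel_measurableI_le) (auto simp: borel_closed)
  moreover have "(\<lambda>v::real^2. Complex (v $ 1) (v $ 2)) \<in> borel_measurable borel"
    by (intro borel_measurable_continuous_onI) (auto simp: Complex_eq intro!: continuous_intros)
  ultimately show ?thesis
    unfolding angle_of_def by (rule measurable_compose[rotated])
qed

lemma measurable_tangent_angle:
  assumes "arclength_boundary \<Omega> \<gamma>"
  shows "tangent_angle \<gamma> \<in> borel_measurable (lebesgue_on {0..boundary_length \<Omega>})"
proof -
  define P where "P = boundary_length \<Omega>"
  have lip: "1-lipschitz_on {0..P} \<gamma>"
    and ae: "AE s in lebesgue_on {0..P}. \<gamma> differentiable (at s)"
    using assms unfolding arclength_boundary_def P_def Let_def by auto
  have P0: "0 \<le> P" by (simp add: P_def boundary_length_def)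
  define c where "c x = max 0 (min P x)" for x :: real
  have c: "c x \<in> {0..P}" for x using P0 by (auto simp: c_def)
  have cc: "continuous_on UNIV (\<lambda>x. \<gamma> (c x))"
    by (rule continuous_on_compose2[OF lipschitz_on_continuous_on[OF lip]])
       (use c in \<open>auto simp: c_def intro!: continuous_intros\<close>)
  define q where "q n s = real (Suc n) *\<^sub>R (\<gamma> (c (s + inverse (real (Suc n)))) - \<gamma> (c s))" for n s
  have cq: "continuous_on UNIV (q n)" for n
    unfolding q_def by (intro continuous_intros continuous_on_compose2[OF cc]) auto
  have qm: "q n \<in> borel_measurable (lebesgue_on {0..P})" for n
    by (rule continuous_imp_measurable_on_sets_lebesgue)
       (auto intro: continuous_on_subset[OF cq])
  have lim: "(\<lambda>n. q n s) \<longlonglongrightarrow> vector_derivative \<gamma> (at s)"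
    if d: "\<gamma> differentiable (at s)" and s: "s \<in> {0..<P}" for s
  proof -
    define D where "D = vector_derivative \<gamma> (at s)"
    define h where "h n = inverse (real (Suc n))" for n
    have h0: "h n > 0" for n by (simp add: h_def)
    have hlim: "h \<longlonglongrightarrow> 0"
      unfolding h_def by (rule LIMSEQ_inverse_real_of_nat)
    have "(\<gamma> has_derivative (\<lambda>h. h *\<^sub>R D)) (at s)"
      using d unfolding vector_derivative_works has_vector_derivative_def D_def .
    then have "(\<lambda>h. norm (\<gamma> (s + h) - \<gamma> s - h *\<^sub>R D) / norm h) \<midarrow>0\<rightarrow> 0"
      by (simp add: has_derivative_at)
    then have "(\<lambda>n. norm (\<gamma> (s + h n) - \<gamma> s - h n *\<^sub>R D) / norm (h n)) \<longlonglongrightarrow> 0"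
      using hlim h0 by (auto simp: LIMSEQ_SEQ_conv[symmetric] less_imp_neq[THEN not_sym])
    moreover have "norm (\<gamma> (s + h n) - \<gamma> s - h n *\<^sub>R D) / norm (h n) =
        norm ((1 / h n) *\<^sub>R (\<gamma> (s + h n) - \<gamma> s) - D)" for n
    proof -
      have "(1 / h n) *\<^sub>R (\<gamma> (s + h n) - \<gamma> s) - D =
          (1 / h n) *\<^sub>R (\<gamma> (s + h n) - \<gamma> s - h n *\<^sub>R D)"
        using h0[of n] by (simp add: scaleR_diff_right)
      then show ?thesis using h0[of n] by simp
    qed
    ultimately have "(\<lambda>n. norm ((1 / h n) *\<^sub>R (\<gamma> (s + h n) - \<gamma> s) - D)) \<longlonglongrightarrow> 0"
      by simp
    then have "(\<lambda>n. (1 / h n) *\<^sub>R (\<gamma> (s + h n) - \<gamma> s)) \<longlonglongrightarrow> D"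
      by (simp add: tendsto_norm_zero_iff LIM_zero_iff)
    moreover have "\<forall>\<^sub>F n in sequentially. (1 / h n) *\<^sub>R (\<gamma> (s + h n) - \<gamma> s) = q n s"
    proof -
      have "\<forall>\<^sub>F n in sequentially. h n < P - s"
        using hlim s by (intro order_tendstoD) auto
      then show ?thesis
      proof eventually_elim
        case (elim n)
        then have "c (s + h n) = s + h n" "c s = s"
          using s h0[of n] by (auto simp: c_def)
        then show ?case by (simp add: q_def h_def divide_inverse)
      qed
    qed
    ultimately show ?thesis
      unfolding D_def by (rule Lim_transform_eventually)
  qed
  obtain N where N: "N \<in> null_sets (lebesgue_on {0..P})"
      "{s \<in> space (lebesgue_on {0..P}). \<not> \<gamma> differentiable (at s)} \<subseteq> N"
    using ae by (auto simp: eventually_ae_filter)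
  have "negligible (N \<union> {P})"
    using N(1) by (simp add: null_sets_restrict_space negligible_iff_null_sets[symmetric])
  then have "(\<lambda>s. vector_derivative \<gamma> (at s)) measurable_on {0..P}"
  proof (rule measurable_on_limit[rotated])
    show "q n measurable_on {0..P}" for n
      using qm by (subst measurable_on_iff_borel_measurable) auto
    show "(\<lambda>n. q n s) \<longlonglongrightarrow> vector_derivative \<gamma> (at s)" if "s \<in> {0..P} - (N \<union> {P})" for s
      using that N(2) by (intro lim) (auto simp: space_restrict_space)
  qed
  then have "(\<lambda>s. vector_derivative \<gamma> (at s)) \<in> borel_measurable (lebesgue_on {0..P})"
    by (subst (asm) measurable_on_iff_borel_measurable) auto
  then show ?thesis
    unfolding tangent_angle_def P_def using borel_measurable_angle_of by (rule measurable_compose)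
qed

lemma integral_boundary_orientation:
  fixes f :: "real \<Rightarrow> 'b::euclidean_space"
  assumes g: "arclength_boundary \<Omega> \<gamma>"
    and f: "continuous_on UNIV f" and per: "\<And>x. f (x + 2*pi) = f x"
  shows "(\<integral>\<theta>. f \<theta> \<partial>boundary_orientation \<Omega> \<gamma>) =
    (1/4) *\<^sub>R (\<integral>s. f (tangent_angle \<gamma> s) + f (tangent_angle \<gamma> s + pi)
        \<partial>lebesgue_on {0..boundary_length \<Omega>})"
proof -
  define M where "M = lebesgue_on {0..boundary_length \<Omega>}"
  define W where "W = density M (\<lambda>_. ennreal (1/4))"
  have t: "tangent_angle \<gamma> \<in> borel_measurable M"
    unfolding M_def by (rule measurable_tangent_angle[OF g])
  then have tW: "tangent_angle \<gamma> \<in> borel_measurable W" by (simp add: W_def)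
  have "emeasure W (space W) < \<infinity>"
    unfolding W_def M_def
    by (simp add: emeasure_density_const emeasure_restrict_space space_restrict_space
        ennreal_mult_less_top emeasure_lborel_Icc_eq)
  then have W: "finite_measure W" by (intro finite_measureI) auto
  have [measurable]: "f \<in> borel_measurable borel"
    using f by (rule borel_measurable_continuous_onI)
  note [measurable] = t
  show ?thesis
    unfolding boundary_orientation_def M_def[symmetric] W_def[symmetric]
      integral_symm_angular[OF tW W f per]
    unfolding W_def by (subst integral_density) auto
qed

end

(* Let S_M(t) be the integral of |sin(t - p)| dM(p). For the orientation measure of the opaque set,
   S_M(t) is the sum of the lengths of the projections of the segments along the direction t, so it
   is at least the length of the projection of \<Omega>; for the boundary measure it is half the total
   variation of the projected boundary curve, which is at most that length, since almost every line
   meets the boundary in at most two points. Hence the difference F of the two transforms is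
   nonnegative. It has period \<pi>, is 2L-Lipschitz, and its integral over a period is
   2(L - |\<partial>\<Omega>|/2). A nonnegative Lipschitz function with small integral has small maximum, so
   F \<le> 2 sqrt(L (L - |\<partial>\<Omega>|/2)), and this bounds the L^2 norm of F. The Fourier coefficients of
   |sin| at the even frequencies l are of order 1/(l^2 - 1), so Bessel's inequality for F bounds the
   H^{-2} norm of the difference of the measures; the odd frequencies vanish by symmetry. *)

theory Submission
  imports Defs
begin

section \<open>Periodic functions and their Fourier coefficients\<close>

text \<open>For an antiderivative \<open>g\<close> of \<open>f\<close>, the integral over
  \<open>[c, c + T]\<close> is \<open>g (c + T) - g c\<close>, and its derivative in
  \<open>c\<close> is \<open>f (c + T) - f c = 0\<close>.\<close>

lemma integral_periodic_shift:
  fixes f :: "real \<Rightarrow> 'b::euclidean_space"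
  assumes f: "continuous_on UNIV f" and per: "\<And>x. f (x + T) = f x" and T: "0 \<le> T"
  shows "integral {a..a + T} f = integral {0..T} f"
proof -
  \<comment> \<open>One interval that contains every window \<open>[c, c + T]\<close> with
    \<open>c\<close> between \<open>0\<close> and \<open>a\<close>, so that a single antiderivative
    serves them all.\<close>
  define S where "S = {min a 0..max a 0 + T}"
  have "continuous_on S f" by (rule continuous_on_subset[OF f]) auto
  then obtain g where g: "\<And>x. x \<in> S \<Longrightarrow> (g has_vector_derivative f x) (at x within S)"
    unfolding S_def using antiderivative_continuous by blast
  have int: "integral {c..c + T} f = g (c + T) - g c" if "c \<in> {min a 0..max a 0}" for c
  proof (rule integral_unique, rule fundamental_theorem_of_calculus)
    show "(g has_vector_derivative f x) (at x within {c..c + T})" if "x \<in> {c..c + T}" for x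
      using that \<open>c \<in> _\<close> T by (intro has_vector_derivative_within_subset[OF g]) (auto simp: S_def)
  qed (use T in auto)
  have "\<exists>k. \<forall>c\<in>{min a 0..max a 0}. g (c + T) - g c = k"
  proof (rule has_vector_derivative_zero_constant[of "{min a 0..max a 0}" "\<lambda>c. g (c + T) - g c"])
    fix c assume c: "c \<in> {min a 0..max a 0}"
    have 1: "(g has_vector_derivative f c) (at c within {min a 0..max a 0})"
      using c T by (intro has_vector_derivative_within_subset[OF g]) (auto simp: S_def)
    have "(g has_vector_derivative f (c + T)) (at (c + T) within (\<lambda>x. x + T) ` {min a 0..max a 0})"
      using c T by (intro has_vector_derivative_within_subset[OF g]) (auto simp: S_def)
    then have "((g \<circ> (\<lambda>x. x + T)) has_vector_derivative (1 *\<^sub>R f (c + T)))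
        (at c within {min a 0..max a 0})"
      by (intro vector_diff_chain_within) (auto intro!: derivative_eq_intros)
    from has_vector_derivative_diff[OF this 1]
    show "((\<lambda>c. g (c + T) - g c) has_vector_derivative 0) (at c within {min a 0..max a 0})"
      by (simp add: per o_def)
  qed auto
  then have "g (a + T) - g a = g (0 + T) - g 0" by (metis (no_types, lifting) atLeastAtMost_iff max.cobounded1 max.cobounded2 min.cobounded1 min.cobounded2)
  then show ?thesis using int[of a] int[of 0] by simp
qed

section \<open>Characters of period \<pi> and the Fourier coefficients of |sin|\<close>

lemma integral_exp_period:
  fixes k :: int
  shows "integral {0..pi} (\<lambda>t. exp (2 * \<i> * of_int k * of_real t)) = (if k = 0 then of_real pi else 0)"
proof (cases "k = 0")
  case False
  have "((\<lambda>t. exp (2 * \<i> * of_int k * of_real t)) has_integral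
      exp (2 * \<i> * of_int k * of_real pi) / (2 * \<i> * of_int k) - exp (2 * \<i> * of_int k * of_real 0) / (2 * \<i> * of_int k)) {0..pi}"
    by (rule fundamental_theorem_of_calculus)
      (use False in \<open>auto intro!: derivative_eq_intros has_vector_derivative_real_field simp: divide_simps\<close>)
  moreover have "exp (2 * \<i> * of_int k * of_real pi) = 1"
    using exp_integer_2pi[of "of_int k"] by (simp add: ac_simps)
  ultimately show ?thesis using False by (simp add: integral_unique)
qed (simp add: scaleR_conv_of_real)

lemma integral_sin_exp:
  fixes k :: int
  shows "integral {0..pi} (\<lambda>t. of_real (sin t) * exp (- 2 * \<i> * of_int k * of_real t))
    = 2 / (1 - 4 * of_int k ^ 2)"
proof -
  \<comment> \<open>No integer satisfies \<open>4 * k^2 = 1\<close>, so the multiplier below never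
    has a zero denominator.\<close>
  have nz: "1 - 4 * (of_int k :: complex) ^ 2 \<noteq> 0"
  proof
    assume "1 - 4 * (of_int k :: complex) ^ 2 = 0"
    then have "(of_int (4 * k^2) :: complex) = of_int 1" by simp
    then have "4 * k^2 = 1" unfolding of_int_eq_iff .
    then show False by presburger
  qed
  \<comment> \<open>With \<open>c = - 2 * \<i> * k\<close>, an antiderivative of
    \<open>exp (c z) * sin z\<close> is \<open>exp (c z) * (c * sin z - cos z) / (1 + c^2)\<close>,
    as two integrations by parts show.\<close>
  define g where "g z = exp (- 2 * \<i> * of_int k * z) * (- cos z - 2 * \<i> * of_int k * sin z) / (1 - 4 * of_int k ^ 2)" for z :: complex
  have d: "(g has_field_derivative sin z * exp (- 2 * \<i> * of_int k * z)) (at z within A)" for z A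
  proof -
    have "(g has_field_derivative (sin z * exp (- 2 * \<i> * of_int k * z) * (1 - 4 * of_int k ^ 2)) /
        (1 - 4 * of_int k ^ 2)) (at z within A)"
      unfolding g_def by (rule DERIV_cdivide)
        (auto intro!: derivative_eq_intros simp: algebra_simps power2_eq_square)
    then show ?thesis using nz by simp
  qed
  have "((\<lambda>t. sin (of_real t) * exp (- 2 * \<i> * of_int k * of_real t)) has_integral g (of_real pi) - g (of_real 0)) {0..pi}"
    by (rule fundamental_theorem_of_calculus) (use d in \<open>auto intro: has_vector_derivative_real_field\<close>)
  moreover have "exp (- 2 * \<i> * of_int k * of_real pi) = 1"
    using exp_integer_2pi[of "of_int (-k)"] by (simp add: ac_simps)
  then have "g (of_real pi) - g (of_real 0) = 2 / (1 - 4 * of_int k ^ 2)"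
    by (simp add: g_def cos_of_real sin_of_real add_divide_distrib[symmetric])
  ultimately show ?thesis by (simp add: integral_unique sin_of_real)
qed

lemma integral_abs_sin_exp:
  fixes k :: int
  shows "integral {0..pi} (\<lambda>t. of_real \<bar>sin (t - p)\<bar> * exp (- 2 * \<i> * of_int k * of_real t))
    = 2 / (1 - 4 * of_int k ^ 2) * exp (- 2 * \<i> * of_int k * of_real p)"
proof -
  define q :: "real \<Rightarrow> complex"
    where "q u = of_real \<bar>sin u\<bar> * exp (- 2 * \<i> * of_int k * of_real u)" for u
  have c: "continuous_on UNIV q" unfolding q_def by (intro continuous_intros)
  have "exp (- 2 * \<i> * of_int k * of_real (u + pi)) = exp (- 2 * \<i> * of_int k * of_real u)" for u
  proof -
    have "- 2 * \<i> * of_int k * of_real (u + pi) = - 2 * \<i> * of_int k * of_real u + 2 * of_int (-k) * of_real pi * \<i>"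
      by (simp add: algebra_simps)
    then show ?thesis using exp_integer_2pi[of "of_int (-k)"] by (simp only: exp_add) simp
  qed
  then have per: "q (u + pi) = q u" for u by (simp add: q_def)
  have "integral {0..pi} (\<lambda>t. of_real \<bar>sin (t - p)\<bar> * exp (- 2 * \<i> * of_int k * of_real t))
      = integral {0..pi} (\<lambda>t. exp (- 2 * \<i> * of_int k * of_real p) * q (t - p))"
    by (intro integral_cong) (simp add: q_def exp_add[symmetric] algebra_simps)
  also have "\<dots> = exp (- 2 * \<i> * of_int k * of_real p) * integral {0..pi} (\<lambda>t. q (t - p))"
    by (rule integral_mult_right)
  also have "integral {0..pi} (\<lambda>t. q (t - p)) = integral {-p..-p + pi} q"
    using integral_shift_real_ivl[of "-p" "-p" "-p+pi" q] by simp
  also have "\<dots> = integral {0..pi} q" by (rule integral_periodic_shift[OF c per]) simp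
  also have "\<dots> = 2 / (1 - 4 * of_int k ^ 2)"
    unfolding integral_sin_exp[symmetric] by (intro integral_cong) (auto simp: q_def sin_ge_zero)
  finally show ?thesis by simp
qed

section \<open>Bessel's inequality over one period\<close>

lemma integral_complex_of_real_Icc:
  fixes f :: "real \<Rightarrow> real"
  assumes "continuous_on {a..b} f"
  shows "integral {a..b} (\<lambda>t. complex_of_real (f t)) = of_real (integral {a..b} f)"
  using integral_linear[OF integrable_continuous_interval[OF assms] bounded_linear_of_real]
  by (simp add: o_def)

text \<open>Expand the nonnegative integral of \<open>|pi * f - s|^2\<close>, where \<open>s\<close>
  is the partial sum with the unnormalized coefficients \<open>c k\<close>. Since the
  \<open>e k\<close> are orthogonal with squared norm \<pi>, the result is \<pi> times the
  difference of the two sides. Scaling \<open>f\<close> by \<pi> avoids dividing the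
  coefficients.\<close>

lemma bessel_inequality_period_pi:
  fixes f :: "real \<Rightarrow> real"
  assumes f: "continuous_on {0..pi} f" and S: "finite S"
  shows "(\<Sum>k\<in>S. (cmod (integral {0..pi} (\<lambda>t. of_real (f t) * exp (- 2 * \<i> * of_int k * of_real t))))\<^sup>2)
    \<le> pi * integral {0..pi} (\<lambda>t. (f t)\<^sup>2)"
proof -
  define e :: "int \<Rightarrow> real \<Rightarrow> complex" where "e k t = exp (2 * \<i> * of_int k * of_real t)" for k t
  define c where "c k = integral {0..pi} (\<lambda>t. of_real (f t) * e (- k) t)" for k
  define A where "A = (\<Sum>k\<in>S. (cmod (c k))\<^sup>2)"
  have cont: "continuous_on {0..pi} (e k)" for k unfolding e_def by (intro continuous_intros)
  have cnj_e: "cnj (e k t) = e (- k) t" for k t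
    by (simp add: e_def exp_cnj)
  have ee: "integral {0..pi} (\<lambda>t. e k t * e (- j) t) = (if k = j then of_real pi else 0)" for k j
    using integral_exp_period[of "k - j"] by (simp add: e_def exp_add[symmetric] algebra_simps)
  have cc: "integral {0..pi} (\<lambda>t. of_real (f t) * e k t) = cnj (c k)" for k
    unfolding c_def integral_cnj by (intro integral_cong) (simp add: cnj_e)
  define s where "s t = (\<Sum>k\<in>S. c k * e k t)" for t
  have conts: "continuous_on {0..pi} s" unfolding s_def by (intro continuous_intros cont)
  have contf: "continuous_on {0..pi} (\<lambda>t. of_real (f t) :: complex)" using f by (intro continuous_intros)
  note ints = integrable_continuous_interval
  have fs: "integral {0..pi} (\<lambda>t. of_real (f t) * s t) = of_real A"
  proof -
    have "integral {0..pi} (\<lambda>t. of_real (f t) * s t)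
        = integral {0..pi} (\<lambda>t. \<Sum>k\<in>S. c k * (of_real (f t) * e k t))"
      by (intro integral_cong) (simp add: s_def sum_distrib_left ac_simps)
    also have "\<dots> = (\<Sum>k\<in>S. c k * cnj (c k))"
      using S by (subst integral_sum)
        (auto simp: cc intro!: ints continuous_intros contf cont sum.cong)
    finally show ?thesis by (simp add: A_def complex_norm_square del: of_real_power)
  qed
  have ss: "integral {0..pi} (\<lambda>t. s t * cnj (s t)) = of_real (pi * A)"
  proof -
    have "integral {0..pi} (\<lambda>t. s t * cnj (s t))
        = integral {0..pi} (\<lambda>t. \<Sum>k\<in>S. \<Sum>j\<in>S. c k * cnj (c j) * (e k t * e (- j) t))"
      by (intro integral_cong) (simp add: s_def sum_product cnj_e ac_simps)
    also have "\<dots> = (\<Sum>k\<in>S. \<Sum>j\<in>S. c k * cnj (c j) * (if k = j then of_real pi else 0))"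
      using S by (subst integral_sum, simp, force intro!: ints continuous_intros cont, intro sum.cong refl)
        (subst integral_sum, auto simp: ee intro!: ints continuous_intros cont sum.cong)
    also have "\<dots> = (\<Sum>k\<in>S. c k * cnj (c k) * of_real pi)"
      using S by (intro sum.cong refl) (simp add: sum.delta' if_distrib cong: if_cong)
    finally show ?thesis
      by (simp add: A_def complex_norm_square sum_distrib_left ac_simps del: of_real_power)
  qed
  have nonneg: "0 \<le> integral {0..pi} (\<lambda>t. (cmod (of_real (pi * f t) - s t))\<^sup>2)"
    by (intro integral_nonneg ints continuous_intros conts f) auto
  have "complex_of_real (integral {0..pi} (\<lambda>t. (cmod (of_real (pi * f t) - s t))\<^sup>2)) = integral {0..pi} (\<lambda>t. of_real ((cmod (of_real (pi * f t) - s t))\<^sup>2))"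
    by (intro integral_complex_of_real_Icc[symmetric] continuous_intros f conts)
  also have "\<dots> = integral {0..pi} (\<lambda>t. of_real (pi\<^sup>2 * (f t)\<^sup>2) - of_real pi * (of_real (f t) * s t)
      - of_real pi * cnj (of_real (f t) * s t) + s t * cnj (s t))"
    by (intro integral_cong, simp only: complex_norm_square) (simp add: algebra_simps power2_eq_square)
  also have "\<dots> = of_real (pi\<^sup>2 * integral {0..pi} (\<lambda>t. (f t)\<^sup>2)) - of_real pi * of_real A - of_real pi * cnj (of_real A) + of_real (pi * A)"
  proof -
    have "integral {0..pi} (\<lambda>t. cnj (of_real (f t) * s t)) = cnj (of_real A)"
      unfolding fs[symmetric] integral_cnj ..
    moreover have "integral {0..pi} (\<lambda>t. complex_of_real (pi\<^sup>2 * (f t)\<^sup>2)) = of_real (pi\<^sup>2 * integral {0..pi} (\<lambda>t. (f t)\<^sup>2))"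
      by (subst integral_complex_of_real_Icc) (auto intro!: continuous_intros f)
    ultimately show ?thesis
      using fs ss
      by (subst integral_add integral_diff integral_mult_right;
          (intro ints continuous_intros conts contf f)?)+ simp
  qed
  also have "\<dots> = complex_of_real (pi\<^sup>2 * integral {0..pi} (\<lambda>t. (f t)\<^sup>2) - pi * A)"
    by simp
  finally have "0 \<le> pi\<^sup>2 * integral {0..pi} (\<lambda>t. (f t)\<^sup>2) - pi * A"
    using nonneg by (simp only: of_real_eq_iff)
  then have "pi * A \<le> pi * (pi * integral {0..pi} (\<lambda>t. (f t)\<^sup>2))" by (simp add: power2_eq_square)
  then have "A \<le> pi * integral {0..pi} (\<lambda>t. (f t)\<^sup>2)" by simp
  then show ?thesis by (simp add: A_def c_def e_def)
qed

text \<open>The graph of \<open>f\<close> lies above a tent with apex \<open>f x\<close> at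
  \<open>x\<close> and slopes \<open>K\<close> and \<open>-K\<close>. By \<open>fK\<close> its base,
  of length \<open>2 * f x / K\<close>, fits into one period, and its area is
  \<open>(f x)^2 / K\<close>.\<close>

lemma lipschitz_periodic_peak_bound:
  fixes f :: "real \<Rightarrow> real"
  assumes lip: "\<And>x y. \<bar>f x - f y\<bar> \<le> K * \<bar>x - y\<bar>"
    and per: "\<And>x. f (x + T) = f x" and T: "0 \<le> T"
    and f0: "\<And>x. 0 \<le> f x" and fK: "2 * f x \<le> T * K" and K: "0 \<le> K"
  shows "(f x)\<^sup>2 \<le> K * integral {0..T} f"
proof (cases "K = 0")
  case True
  then show ?thesis using fK f0[of x] by simp
next
  case False
  then have K: "0 < K" using K by simp
  have c: "continuous_on A f" for A
  proof -
    have "K-lipschitz_on A f" using lip K by (auto simp: lipschitz_on_def dist_real_def)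
    then show ?thesis by (rule lipschitz_on_continuous_on)
  qed
  define d where "d = f x / K"
  have d0: "0 \<le> d" and dT: "2 * d \<le> T" and Kd: "K * d = f x"
    using K f0[of x] fK by (auto simp: d_def field_simps)
  then have Kd': "K * d\<^sup>2 = f x * d" by (simp add: power2_eq_square)
  \<comment> \<open>The sign \<open>s\<close> is \<open>1\<close> on the left flank of the tent and
    \<open>-1\<close> on the right one.\<close>
  have ftc: "((\<lambda>t. f x + s * K * (t - x)) has_integral
      (f x * v + s * K * (v - x)\<^sup>2 / 2) - (f x * u + s * K * (u - x)\<^sup>2 / 2)) {u..v}" if "u \<le> v" for s u v
    by (rule fundamental_theorem_of_calculus[OF that])
      (auto intro!: derivative_eq_intros simp: has_real_derivative_iff_has_vector_derivative[symmetric])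
  have "f x * d / 2 \<le> integral {x - d..x} f"
  proof -
    have "f x + 1 * K * (t - x) \<le> f t" if "t \<in> {x-d..x}" for t
      using lip[of x t] that by (auto simp: abs_if algebra_simps split: if_splits)
    then have "integral {x-d..x} (\<lambda>t. f x + 1 * K * (t - x)) \<le> integral {x-d..x} f"
      by (intro integral_le integrable_continuous_interval c continuous_intros) auto
    moreover have "integral {x-d..x} (\<lambda>t. f x + 1 * K * (t - x)) = f x * d / 2"
      using integral_unique[OF ftc[of "x-d" x 1]] d0 Kd'
      by (simp del: mult_1 mult_minus1) (simp add: algebra_simps)
    ultimately show ?thesis by simp
  qed
  moreover have "f x * d / 2 \<le> integral {x..x + d} f"
  proof -
    have "f x + (-1) * K * (t - x) \<le> f t" if "t \<in> {x..x+d}" for t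
      using lip[of x t] that by (auto simp: abs_if algebra_simps split: if_splits)
    then have "integral {x..x+d} (\<lambda>t. f x + (-1) * K * (t - x)) \<le> integral {x..x+d} f"
      by (intro integral_le integrable_continuous_interval c continuous_intros) auto
    moreover have "integral {x..x+d} (\<lambda>t. f x + (-1) * K * (t - x)) = f x * d / 2"
      using integral_unique[OF ftc[of x "x+d" "-1"]] d0 Kd'
      by (simp del: mult_1 mult_minus1) (simp add: algebra_simps)
    ultimately show ?thesis by simp
  qed
  moreover have "integral {x-d..x} f + integral {x..x+d} f = integral {x-d..x+d} f"
    using d0 by (intro Henstock_Kurzweil_Integration.integral_combine integrable_continuous_interval c) auto
  \<comment> \<open>Here \<open>2 * d \<le> T\<close> and \<open>0 \<le> f\<close> allow the base of
    the tent to be enlarged to a full period.\<close>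
  moreover have "integral {x-d..x+d} f \<le> integral {x-d..(x-d)+T} f"
    using f0 dT by (intro integral_subset_le integrable_continuous_interval c) auto
  moreover have "integral {x-d..(x-d)+T} f = integral {0..T} f"
    by (rule integral_periodic_shift[OF c per T])
  ultimately have "f x * d \<le> integral {0..T} f" by simp
  then have "K * (f x * d) \<le> K * integral {0..T} f" using K by simp
  moreover have "K * (f x * d) = (f x)\<^sup>2" using Kd by (simp add: power2_eq_square)
  ultimately show ?thesis by simp
qed

section \<open>The sine transform of a measure\<close>

text \<open>The cosine transform of convex geometry, turned by a right angle. For the orientation
  measure of a family of segments, its value at \<open>t\<close> is the total length of their
  projections along direction \<open>t\<close>.\<close>

definition sine_transform :: "real measure \<Rightarrow> real \<Rightarrow> real" where
  "sine_transform M t = (\<integral>p. \<bar>sin (t - p)\<bar> \<partial>M)"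

lemma sine_transform_nonneg: "0 \<le> sine_transform M t"
  unfolding sine_transform_def by simp

lemma sine_transform_periodic: "sine_transform M (t + pi) = sine_transform M t"
proof -
  have "\<bar>sin (t + pi - p)\<bar> = \<bar>sin (t - p)\<bar>" for p
    using sin_periodic_pi[of "t - p"] by (simp add: algebra_simps)
  then show ?thesis by (simp add: sine_transform_def)
qed

context
  fixes M :: "real measure"
  assumes fin: "finite_measure M" and id_meas [measurable]: "(\<lambda>x. x) \<in> borel_measurable M"
begin

text \<open>A bounded integrand against a finite measure. Assuming \<open>id_meas\<close> lets
  \<open>M\<close> live on a trace sigma-algebra such as \<open>circle_borel\<close>.\<close>

lemma integrable_abs_sin_diff: "integrable M (\<lambda>p. \<bar>sin (t - p)\<bar>)"
  by (rule finite_measure.integrable_const_bound[OF fin, where B = 1]) auto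

lemma sine_transform_le: "sine_transform M t \<le> measure M (space M)"
proof -
  have "sine_transform M t \<le> (\<integral>p. 1 \<partial>M)"
    unfolding sine_transform_def
    by (rule integral_mono[OF integrable_abs_sin_diff]) (use fin in \<open>auto simp: finite_measure.integrable_const\<close>)
  then show ?thesis by simp
qed

lemma sine_transform_lipschitz:
  "\<bar>sine_transform M x - sine_transform M y\<bar> \<le> measure M (space M) * \<bar>x - y\<bar>"
proof -
  have sin: "\<bar>sin u - sin v\<bar> \<le> \<bar>u - v\<bar>" for u v :: real
  proof -
    have "\<bar>sin u - sin v\<bar> = 2 * (\<bar>sin ((u - v) / 2)\<bar> * \<bar>cos ((u + v) / 2)\<bar>)"
      unfolding sin_diff_sin by (simp add: abs_mult)
    also have "\<dots> \<le> 2 * (\<bar>(u - v) / 2\<bar> * 1)"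
      by (intro mult_left_mono mult_mono abs_sin_x_le_abs_x) auto
    finally show ?thesis by simp
  qed
  have "sine_transform M x - sine_transform M y = (\<integral>p. \<bar>sin (x - p)\<bar> - \<bar>sin (y - p)\<bar> \<partial>M)"
    unfolding sine_transform_def by (rule Bochner_Integration.integral_diff[symmetric]) (rule integrable_abs_sin_diff)+
  also have "\<bar>\<dots>\<bar> \<le> (\<integral>p. \<bar>\<bar>sin (x - p)\<bar> - \<bar>sin (y - p)\<bar>\<bar> \<partial>M)"
    by (rule integral_abs_bound)
  also have "\<dots> \<le> (\<integral>p. \<bar>x - y\<bar> \<partial>M)"
  proof (rule integral_mono)
    show "\<bar>\<bar>sin (x - p)\<bar> - \<bar>sin (y - p)\<bar>\<bar> \<le> \<bar>x - y\<bar>" for p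
      using sin[of "x - p" "y - p"] abs_triangle_ineq3[of "sin (x - p)" "sin (y - p)"] by simp
  qed (use fin in \<open>auto simp: finite_measure.integrable_const intro!: integrable_abs_sin_diff\<close>)
  finally show ?thesis by simp
qed

lemma continuous_on_sine_transform: "continuous_on A (sine_transform M)"
proof -
  have "(measure M (space M))-lipschitz_on A (sine_transform M)"
    using sine_transform_lipschitz by (auto simp: lipschitz_on_def dist_real_def)
  then show ?thesis by (rule lipschitz_on_continuous_on)
qed

text \<open>The transform is a convolution with |sin|, so by Fubini it acts on the coefficient of
  frequency \<open>2 * k\<close> as a multiplier. The multiplier never vanishes, so the coefficients
  of the measure at even frequencies can be recovered.\<close>

lemma sine_transform_fourier:
  fixes k :: int
  shows "integral {0..pi} (\<lambda>t. of_real (sine_transform M t) * exp (- 2 * \<i> * of_int k * of_real t))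
    = 2 / (1 - 4 * of_int k ^ 2) * (\<integral>p. exp (- 2 * \<i> * of_int k * of_real p) \<partial>M)"
proof -
  define N where "N = restrict_space lborel {0..pi}"
  have N: "finite_measure N"
    unfolding N_def by (rule finite_measureI) (simp add: space_restrict_space emeasure_restrict_space)
  interpret M: finite_measure M by (rule fin)
  interpret N: finite_measure N by (rule N)
  interpret P: pair_sigma_finite N M ..
  have [measurable]: "(\<lambda>x. x) \<in> borel_measurable N"
    unfolding N_def by (rule measurable_restrict_space1) simp
  \<comment> \<open>Fubini is applied to Bochner integrals, whereas the formulas over a period are
    stated for the gauge integral; for continuous functions the two agree.\<close>
  have NI: "(\<integral>t. h t \<partial>N) = integral {0..pi} h" if "continuous_on {0..pi} h" for h :: "real \<Rightarrow> complex"
  proof -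
    have "(\<integral>t. h t \<partial>N) = (LINT t:{0..pi}|lborel. h t)"
      unfolding N_def set_lebesgue_integral_def by (rule integral_restrict_space) simp
    also have "\<dots> = integral {0..pi} h"
      using that by (intro set_borel_integral_eq_integral borel_integrable_atLeastAtMost')
    finally show ?thesis .
  qed
  define h :: "real \<Rightarrow> real \<Rightarrow> complex"
    where "h t p = of_real \<bar>sin (t - p)\<bar> * exp (- 2 * \<i> * of_int k * of_real t)" for t p
  have [measurable]: "fst \<in> borel_measurable (N \<Otimes>\<^sub>M M)" "snd \<in> borel_measurable (N \<Otimes>\<^sub>M M)"
    using measurable_compose[OF measurable_fst \<open>(\<lambda>x. x) \<in> borel_measurable N\<close>]
      measurable_compose[OF measurable_snd id_meas] by simp_all
  have [measurable]: "(\<lambda>x. h (fst x) (snd x)) \<in> borel_measurable (N \<Otimes>\<^sub>M M)"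
    unfolding h_def by measurable
  have int: "integrable (N \<Otimes>\<^sub>M M) (case_prod h)"
    by (rule finite_measure.integrable_const_bound[where B = 1])
      (auto simp: case_prod_beta finite_measure_pair_measure fin N, simp add: h_def norm_mult)
  have "integral {0..pi} (\<lambda>t. of_real (sine_transform M t) * exp (- 2 * \<i> * of_int k * of_real t))
     = (\<integral>t. of_real (sine_transform M t) * exp (- 2 * \<i> * of_int k * of_real t) \<partial>N)"
    by (rule NI[symmetric]) (intro continuous_intros continuous_on_sine_transform)
  also have "\<dots> = (\<integral>t. \<integral>p. h t p \<partial>M \<partial>N)"
    by (simp add: sine_transform_def h_def)
  also have "\<dots> = (\<integral>p. \<integral>t. h t p \<partial>N \<partial>M)"
    by (rule P.Fubini_integral[OF int, symmetric])
  also have "\<dots> = (\<integral>p. 2 / (1 - 4 * of_int k ^ 2) * exp (- 2 * \<i> * of_int k * of_real p) \<partial>M)"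
    unfolding integral_abs_sin_exp[symmetric] h_def
    by (intro Bochner_Integration.integral_cong refl NI continuous_intros)
  finally show ?thesis by simp
qed

end

text \<open>The purely analytic half of the argument: geometry enters only through
  \<open>le\<close>, and the symmetry of the measures only through the vanishing odd
  coefficients.\<close>

lemma Hdot_minus2_norm_diff_le_of_sine_transform_le:
  assumes M: "finite_measure M" "(\<lambda>x. x) \<in> borel_measurable M"
    and N: "finite_measure N" "(\<lambda>x. x) \<in> borel_measurable N"
    and le: "\<And>t. sine_transform N t \<le> sine_transform M t"
    and oddM: "\<And>l. odd l \<Longrightarrow> fourier_coeff M l = 0"
    and oddN: "\<And>l. odd l \<Longrightarrow> fourier_coeff N l = 0"
  shows "Hdot_minus2_norm_diff M N \<le> measure M (space M) powr (1/4) / sqrt 2 *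
    (measure M (space M) - measure N (space N)) powr (3/4)"
proof -
  define m where "m = measure M (space M)"
  define n where "n = measure N (space N)"
  define \<delta> where "\<delta> = m - n"
  define F where "F t = sine_transform M t - sine_transform N t" for t
  define \<nu> where "\<nu> l = fourier_coeff M l - fourier_coeff N l" for l
  define D where "D k = integral {0..pi} (\<lambda>t. of_real (F t) * exp (- 2 * \<i> * of_int k * of_real t))" for k :: int
  have m0: "0 \<le> m" and n0: "0 \<le> n" by (auto simp: m_def n_def)
  have F0: "0 \<le> F t" for t using le by (simp add: F_def)
  have Fm: "F t \<le> m" for t
    using sine_transform_le[OF M, of t] sine_transform_nonneg[of N t] by (simp add: F_def m_def)
  have Fc: "continuous_on A F" for A
    unfolding F_def by (intro continuous_intros continuous_on_sine_transform M N)
  have Dsplit: "D k = 2 / (1 - 4 * of_int k ^ 2) * ((\<integral>p. exp (- 2 * \<i> * of_int k * of_real p) \<partial>M)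
      - (\<integral>p. exp (- 2 * \<i> * of_int k * of_real p) \<partial>N))" for k
  proof -
    have "D k = integral {0..pi} (\<lambda>t. of_real (sine_transform M t) * exp (- 2 * \<i> * of_int k * of_real t)
        - of_real (sine_transform N t) * exp (- 2 * \<i> * of_int k * of_real t))"
      unfolding D_def F_def by (intro integral_cong) (simp add: algebra_simps)
    also have "\<dots> = integral {0..pi} (\<lambda>t. of_real (sine_transform M t) * exp (- 2 * \<i> * of_int k * of_real t))
        - integral {0..pi} (\<lambda>t. of_real (sine_transform N t) * exp (- 2 * \<i> * of_int k * of_real t))"
      by (intro integral_diff integrable_continuous_interval continuous_intros continuous_on_sine_transform M N)
    finally show ?thesis
      unfolding sine_transform_fourier[OF M] sine_transform_fourier[OF N] by (simp add: algebra_simps)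
  qed
  \<comment> \<open>The coefficient at \<open>k = 0\<close>, where the multiplier equals 2 and the
    integrals over \<open>M\<close> and \<open>N\<close> are the masses.\<close>
  have intF: "integral {0..pi} F = 2 * \<delta>"
  proof -
    have "complex_of_real (integral {0..pi} F) = D 0" by (simp add: D_def integral_complex_of_real_Icc Fc)
    also have "\<dots> = of_real (2 * \<delta>)" by (simp add: Dsplit \<delta>_def m_def n_def scaleR_conv_of_real)
    finally show ?thesis by (simp only: of_real_eq_iff)
  qed
  have "0 \<le> integral {0..pi} F" by (rule integral_nonneg) (auto intro: F0 integrable_continuous_interval Fc)
  \<comment> \<open>For the two orientation measures this is Jones' inequality.\<close>
  then have d0: "0 \<le> \<delta>" using intF by simp
  have nm: "n \<le> m" using d0 by (simp add: \<delta>_def)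
  have F2: "(F t)\<^sup>2 \<le> (2 * sqrt (m * \<delta>))\<^sup>2" for t
  proof -
    have "(F t)\<^sup>2 \<le> (2 * m) * integral {0..pi} F"
    proof (rule lipschitz_periodic_peak_bound)
      fix x y
      have "\<bar>F x - F y\<bar> \<le> m * \<bar>x - y\<bar> + n * \<bar>x - y\<bar>"
        using sine_transform_lipschitz[OF M, of x y] sine_transform_lipschitz[OF N, of x y]
        by (simp add: F_def m_def n_def)
      also have "\<dots> \<le> 2 * m * \<bar>x - y\<bar>" using nm by (simp add: distrib_right[symmetric] mult_right_mono)
      finally show "\<bar>F x - F y\<bar> \<le> 2 * m * \<bar>x - y\<bar>" .
      show "F (x + pi) = F x" by (simp add: F_def sine_transform_periodic)
    next
      \<comment> \<open>The tent fits into one period: \<open>F\<close> is at most \<open>m\<close>,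
        while its Lipschitz constant is \<open>2 * m\<close>.\<close>
      have "F t * 1 \<le> m * pi" using Fm m0 pi_gt3 by (intro mult_mono) auto
      then show "2 * F t \<le> pi * (2 * m)" by (simp add: mult.commute)
    qed (use m0 F0 in auto)
    then show ?thesis using intF m0 d0 by (simp add: power_mult_distrib)
  qed
  have "0 \<le> 2 * sqrt (m * \<delta>)" using m0 d0 by simp
  then have FB: "F t \<le> 2 * sqrt (m * \<delta>)" for t using F2 power2_le_imp_le by blast
  \<comment> \<open>One factor of \<open>F^2\<close> is replaced by the maximum of \<open>F\<close>;
    the other integrates to \<open>2 * \<delta>\<close>.\<close>
  have "integral {0..pi} (\<lambda>t. (F t)\<^sup>2) \<le> integral {0..pi} (\<lambda>t. 2 * sqrt (m * \<delta>) * F t)"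
    using FB F0 by (intro integral_le integrable_continuous_interval continuous_intros Fc)
      (auto simp: power2_eq_square intro!: mult_right_mono)
  then have F22: "integral {0..pi} (\<lambda>t. (F t)\<^sup>2) \<le> 4 * \<delta> * sqrt (m * \<delta>)"
    by (simp add: intF mult.commute mult.left_commute)
  \<comment> \<open>Inverting the multiplier gives the factor
    \<open>(1 - 4 * q) / (2 * sqrt (2 * pi))\<close>. Its squared numerator is at most
    \<open>(4 * q)^2 = (2 * k)^4\<close>, which cancels the weight of the norm; the squared
    denominator is \<open>8 * pi\<close>.\<close>
  have term_le: "(cmod (\<nu> (2 * k)))\<^sup>2 / of_int (2 * k) ^ 4 \<le> (cmod (D k))\<^sup>2 / (8 * pi)" if k: "k \<noteq> 0" for k :: int
  proof -
    define q where "q = (of_int k :: real)\<^sup>2"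
    have "1 \<le> k\<^sup>2" using k by (simp add: int_one_le_iff_zero_less)
    then have q1: "1 \<le> q" unfolding q_def by (metis of_int_1_le_iff of_int_power)
    have \<nu>: "\<nu> (2 * k) = of_real (1 / sqrt (2 * pi)) * ((\<integral>p. exp (- 2 * \<i> * of_int k * of_real p) \<partial>M)
      - (\<integral>p. exp (- 2 * \<i> * of_int k * of_real p) \<partial>N))"
      by (simp add: \<nu>_def fourier_coeff_def algebra_simps)
    have nq: "(1 - 4 * of_int k ^ 2 :: complex) = of_real (1 - 4 * q)" by (simp add: q_def)
    have "\<nu> (2 * k) = of_real ((1 - 4 * q) / (2 * sqrt (2 * pi))) * D k"
      unfolding \<nu> Dsplit nq using q1 by (simp add: field_simps del: of_real_diff)
    then have "cmod (\<nu> (2 * k)) = (4 * q - 1) / (2 * sqrt (2 * pi)) * cmod (D k)"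
      using q1 by (simp only: norm_mult norm_of_real) simp
    then have "(cmod (\<nu> (2 * k)))\<^sup>2 = (4 * q - 1)\<^sup>2 * ((cmod (D k))\<^sup>2 / (8 * pi))"
      by (simp add: power_mult_distrib power_divide)
    also have "\<dots> \<le> (4 * q)\<^sup>2 * ((cmod (D k))\<^sup>2 / (8 * pi))"
      using q1 by (intro mult_right_mono power_mono) auto
    also have "(4 * q)\<^sup>2 = of_int (2 * k) ^ 4" by (simp add: q_def power_mult_distrib)
    finally show ?thesis using k by (simp add: divide_le_eq mult.commute)
  qed
  let ?g = "\<lambda>l. (cmod (fourier_coeff M l - fourier_coeff N l))\<^sup>2 / (of_int l) ^ 4"
  \<comment> \<open>This is \<open>pi / (8 * pi)\<close> times the bound \<open>F22\<close>: a
    factor \<pi> from Bessel's inequality and \<open>8 * pi\<close> from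
    \<open>term_le\<close>.\<close>
  define B where "B = \<delta> * sqrt (m * \<delta>) / 2"
  have fin: "sum ?g S \<le> B" if S: "finite S" "S \<subseteq> -{0}" for S
  proof -
    define T where "T = (\<lambda>l. l div 2) ` {l \<in> S. even l}"
    have inj: "inj_on (\<lambda>l. l div 2) {l \<in> S. even l}" by (auto simp: inj_on_def elim!: evenE)
    have "sum ?g S = sum ?g {l \<in> S. even l}"
      using S oddM oddN by (intro sum.mono_neutral_right) auto
    also have "\<dots> = (\<Sum>l\<in>{l \<in> S. even l}. (cmod (\<nu> (2 * (l div 2))))\<^sup>2 / of_int (2 * (l div 2)) ^ 4)"
      by (intro sum.cong) (auto simp: \<nu>_def)
    also have "\<dots> \<le> (\<Sum>l\<in>{l \<in> S. even l}. (cmod (D (l div 2)))\<^sup>2 / (8 * pi))"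
      using S by (intro sum_mono term_le) (auto elim!: evenE)
    also have "\<dots> = (\<Sum>k\<in>T. (cmod (D k))\<^sup>2 / (8 * pi))"
      unfolding T_def by (simp add: sum.reindex[OF inj])
    also have "\<dots> = (\<Sum>k\<in>T. (cmod (D k))\<^sup>2) / (8 * pi)"
      by (simp add: sum_divide_distrib)
    also have "\<dots> \<le> pi * integral {0..pi} (\<lambda>t. (F t)\<^sup>2) / (8 * pi)"
      unfolding D_def using S by (intro divide_right_mono bessel_inequality_period_pi Fc) (auto simp: T_def)
    also have "\<dots> \<le> B" using F22 by (simp add: B_def)
    finally show ?thesis .
  qed
  have B0: "0 \<le> B" using m0 d0 by (simp add: B_def)
  have "infsum ?g (-{0}) \<le> B"
  proof (cases "?g summable_on (-{0})")
    case True
    then show ?thesis using fin by (rule infsum_le_finite_sums)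
  next
    \<comment> \<open>An infinite sum that does not exist has the default value 0, so
      \<open>0 \<le> B\<close> settles this case.\<close>
    case False
    then show ?thesis using B0 by (simp add: infsum_not_exists)
  qed
  then have "Hdot_minus2_norm_diff M N \<le> sqrt B"
    unfolding Hdot_minus2_norm_diff_def by (rule real_sqrt_le_mono)
  also have "sqrt B = m powr (1/4) / sqrt 2 * \<delta> powr (3/4)"
  proof (rule real_sqrt_unique)
    have "\<delta> * \<delta> powr (1/2) = \<delta> powr (3/2)"
      using powr_mult_base[OF d0, of "1/2"] by simp
    moreover have "sqrt (m * \<delta>) = m powr (1/2) * \<delta> powr (1/2)"
      using m0 d0 by (simp add: powr_half_sqrt[symmetric] powr_mult)
    moreover have "m powr (1/4) * m powr (1/4) = m powr (1/2)" "\<delta> powr (3/4) * \<delta> powr (3/4) = \<delta> powr (3/2)"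
      by (simp_all flip: powr_add)
    ultimately show "(m powr (1/4) / sqrt 2 * \<delta> powr (3/4))\<^sup>2 = B"
      by (simp add: B_def power_mult_distrib power_divide) (simp add: power2_eq_square)
  qed simp
  finally show ?thesis by (simp add: m_def n_def \<delta>_def)
qed

section \<open>Projections of opaque sets and of convex curves\<close>

lemma angle_of_polar:
  "v $ 1 = norm v * cos (angle_of v)" "v $ 2 = norm v * sin (angle_of v)"
proof -
  define z where "z = Complex (v $ 1) (v $ 2)"
  have "z = of_real (cmod z) * exp (\<i> * of_real (Arg2pi z))" by (rule Arg2pi_eq)
  moreover have "cmod z = norm v"
    by (simp add: z_def cmod_def norm_vec_def L2_set_def sum_2)
  ultimately have z: "z = of_real (norm v) * exp (\<i> * of_real (angle_of v))"
    by (simp add: angle_of_def z_def)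
  have "Re z = norm v * cos (angle_of v)" by (subst z) (simp add: Re_exp)
  moreover have "Im z = norm v * sin (angle_of v)" by (subst z) (simp add: Im_exp)
  ultimately show "v $ 1 = norm v * cos (angle_of v)" "v $ 2 = norm v * sin (angle_of v)"
    by (simp_all add: z_def)
qed

text \<open>The vector on the left is the unit normal to direction \<open>t\<close>, which
  identifies the kernel of the sine transform with the length of a projection.\<close>

lemma abs_inner_normal_eq_sin:
  fixes v :: "real^2"
  shows "\<bar>vector [- sin t, cos t] \<bullet> v\<bar> = norm v * \<bar>sin (t - angle_of v)\<bar>"
proof -
  have "vector [- sin t, cos t] \<bullet> v = - (norm v * sin (t - angle_of v))"
    using angle_of_polar[of v] by (simp add: inner_vec_def sum_2 sin_diff algebra_simps)
  then show ?thesis by (simp add: abs_mult)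
qed

text \<open>The level line of \<open>n\<close> through a point of \<open>S\<close> meets \<Omega>,
  hence some segment. So the projections of the segments cover that of \<open>S\<close>, and
  countable subadditivity applies. Later \<open>S\<close> is the interior of \<Omega>, whose
  projection is open.\<close>

lemma emeasure_projection_le_segments:
  fixes n :: "real^2"
  assumes opq: "opaque_set \<O> \<Omega>" and seg: "segment_union \<O> I a b" and n: "n \<noteq> 0"
    and S: "S \<subseteq> \<Omega>"
  shows "emeasure lborel ((\<lambda>x. n \<bullet> x) ` S) \<le> (\<integral>\<^sup>+i. ennreal \<bar>n \<bullet> (b i - a i)\<bar> \<partial>count_space I)"
proof -
  define A where "A i = (if i \<in> I then closed_segment (n \<bullet> a i) (n \<bullet> b i) else {})" for i
  have "(\<lambda>x. n \<bullet> x) ` S \<subseteq> (\<Union>i. A i)"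
  proof clarify
    fix x assume "x \<in> S"
    define l where "l = {z. n \<bullet> z = n \<bullet> x}"
    have "affine l" unfolding l_def by (rule affine_hyperplane)
    moreover have "aff_dim l = 1" using n by (simp add: l_def)
    moreover have "x \<in> l \<inter> \<Omega>" using \<open>x \<in> S\<close> S by (auto simp: l_def)
    ultimately have "l \<inter> \<O> \<noteq> {}" using opq unfolding opaque_set_def by blast
    then obtain z i where z: "n \<bullet> z = n \<bullet> x" "i \<in> I" "z \<in> closed_segment (a i) (b i)"
      using seg by (auto simp: segment_union_def l_def)
    then obtain u where u: "0 \<le> u" "u \<le> 1" "z = (1 - u) *\<^sub>R a i + u *\<^sub>R b i"
      by (auto simp: in_segment)
    then have "n \<bullet> z \<in> closed_segment (n \<bullet> a i) (n \<bullet> b i)"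
      unfolding in_segment by (intro exI[of _ u]) (simp add: inner_add_right)
    then have "n \<bullet> x \<in> A i" using z by (simp add: A_def)
    then show "n \<bullet> x \<in> (\<Union>i. A i)" by blast
  qed
  moreover have A: "A i \<in> sets lborel" for i by (simp add: A_def)
  ultimately have "emeasure lborel ((\<lambda>x. n \<bullet> x) ` S) \<le> emeasure lborel (\<Union>i. A i)"
    by (intro emeasure_mono) auto
  also have "\<dots> \<le> (\<Sum>i. emeasure lborel (A i))"
    using A by (intro emeasure_subadditive_countably) auto
  also have "\<dots> = (\<integral>\<^sup>+i. ennreal \<bar>n \<bullet> (b i - a i)\<bar> * indicator I i \<partial>count_space UNIV)"
    unfolding nn_integral_count_space_nat
    by (intro suminf_cong) (auto simp: A_def closed_segment_eq_real_ivl inner_diff_right indicator_def)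
  also have "\<dots> = (\<integral>\<^sup>+i. ennreal \<bar>n \<bullet> (b i - a i)\<bar> \<partial>count_space I)"
    by (rule nn_integral_count_space_indicator[symmetric]) simp
  finally show ?thesis .
qed

section \<open>Level sets and total variation of a projected convex boundary\<close>

lemma convex_frontier_line_two_points:
  fixes S :: "'a::euclidean_space set"
  assumes S: "convex S" and p: "p \<in> interior S"
  obtains v w where "\<And>u. p + u *\<^sub>R d \<in> frontier S \<Longrightarrow> u = v \<or> u = w"
proof -
  \<comment> \<open>Of two frontier points on one ray from \<open>p\<close>, the nearer one lies on
    the open segment from the interior point \<open>p\<close> to a point of the closure, and so
    would be interior.\<close>
  have *: "False" if "p + u *\<^sub>R e \<in> frontier S" "p + w *\<^sub>R e \<in> frontier S" "0 < u" "u < w" for u w e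
  proof -
    have e: "e \<noteq> 0" using that(1) p by (auto simp: frontier_def)
    have "p + u *\<^sub>R e \<in> open_segment p (p + w *\<^sub>R e)"
      using that e unfolding in_segment
      by (intro conjI exI[of _ "u / w"]) (auto simp: algebra_simps)
    moreover have "open_segment p (p + w *\<^sub>R e) \<subseteq> interior S"
      using that(2) by (intro in_interior_closure_convex_segment[OF S p]) (simp add: frontier_def)
    ultimately show False using that(1) by (auto simp: frontier_def)
  qed
  have pos: "u = w" if "p + u *\<^sub>R e \<in> frontier S" "p + w *\<^sub>R e \<in> frontier S" "0 < u" "0 < w" for u w e
    using *[of u e w] *[of w e u] that by (meson linorder_neqE_linordered_idom)
  show ?thesis
  proof
    fix u assume u: "p + u *\<^sub>R d \<in> frontier S"
    have "u \<noteq> 0" using u p by (auto simp: frontier_def)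
    then consider "0 < u" | "u < 0" by linarith
    \<comment> \<open>One candidate for each of the two rays. A ray may miss the frontier, and then
      its candidate is arbitrary, but \<open>u\<close> itself shows that the ray in question does
      not.\<close>
    then show "u = (SOME v. 0 < v \<and> p + v *\<^sub>R d \<in> frontier S) \<or>
        u = (SOME w. w < 0 \<and> p + w *\<^sub>R d \<in> frontier S)"
    proof cases
      case 1
      have "0 < (SOME v. 0 < v \<and> p + v *\<^sub>R d \<in> frontier S) \<and>
          p + (SOME v. 0 < v \<and> p + v *\<^sub>R d \<in> frontier S) *\<^sub>R d \<in> frontier S"
        by (rule someI[of _ u]) (use 1 u in auto)
      then show ?thesis using pos[of u d] u 1 by blast
    next
      case 2
      have "(SOME w. w < 0 \<and> p + w *\<^sub>R d \<in> frontier S) < 0 \<and>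
          p + (SOME w. w < 0 \<and> p + w *\<^sub>R d \<in> frontier S) *\<^sub>R d \<in> frontier S"
        by (rule someI[of _ u]) (use 2 u in auto)
      then show ?thesis using pos[of "-u" "-d" "- (SOME w. w < 0 \<and> p + w *\<^sub>R d \<in> frontier S)"] u 2
        by auto
    qed
  qed
qed

text \<open>In the plane the level line is spanned by \<open>n\<close> turned through a right angle,
  so the bound for lines through an interior point applies. Only levels over the interior are
  considered, because a supporting line may contain a whole edge.\<close>

lemma convex_frontier_level_two_points:
  fixes n :: "real^2"
  assumes S: "convex S" and n: "n \<noteq> 0" and t: "t \<in> (\<lambda>x. n \<bullet> x) ` interior S"
  obtains y z where "\<And>x. x \<in> frontier S \<Longrightarrow> n \<bullet> x = t \<Longrightarrow> x = y \<or> x = z"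
proof -
  obtain p where p: "p \<in> interior S" "t = n \<bullet> p" using t by auto
  define d :: "real^2" where "d = vector [- n $ 2, n $ 1]"
  obtain v w where vw: "\<And>u. p + u *\<^sub>R d \<in> frontier S \<Longrightarrow> u = v \<or> u = w"
    using convex_frontier_line_two_points[OF S p(1), of d] by blast
  show ?thesis
  proof
    fix x assume x: "x \<in> frontier S" "n \<bullet> x = t"
    \<comment> \<open>The coefficient of \<open>x - p\<close> along \<open>d\<close>; the
      denominator is right because \<open>d\<close> and \<open>n\<close> have the same
      length.\<close>
    define u where "u = ((x - p) \<bullet> d) / (n \<bullet> n)"
    have nn: "n \<bullet> n \<noteq> 0" using n by simp
    have "n $ 1 * (x $ 1 - p $ 1) + n $ 2 * (x $ 2 - p $ 2) = 0"
      using x(2) p(2) by (simp add: inner_vec_def sum_2 algebra_simps)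
    then have e: "n $ 1 * (x $ 1 - p $ 1) = - (n $ 2 * (x $ 2 - p $ 2))" by linarith
    have "(n \<bullet> n) *\<^sub>R (x - p) = ((x - p) \<bullet> d) *\<^sub>R d"
    proof -
      have "((n \<bullet> n) *\<^sub>R (x - p)) $ 1 = (((x - p) \<bullet> d) *\<^sub>R d) $ 1"
        using e by (simp add: inner_vec_def sum_2 d_def) algebra
      moreover have "((n \<bullet> n) *\<^sub>R (x - p)) $ 2 = (((x - p) \<bullet> d) *\<^sub>R d) $ 2"
        using e by (simp add: inner_vec_def sum_2 d_def) algebra
      ultimately show ?thesis by (simp only: vec_eq_iff forall_2)
    qed
    then have "(1 / (n \<bullet> n)) *\<^sub>R ((n \<bullet> n) *\<^sub>R (x - p)) = (1 / (n \<bullet> n)) *\<^sub>R (((x - p) \<bullet> d) *\<^sub>R d)"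
      by simp
    then have "x = p + u *\<^sub>R d" using nn by (simp add: u_def diff_eq_eq add.commute)
    then show "x = p + v *\<^sub>R d \<or> x = p + w *\<^sub>R d" using vw x(1) by blast
  qed
qed

text \<open>Tonelli: a level \<open>t\<close> lies between \<open>g s\<close> and \<open>g (s + h)\<close> only if \<open>[s, s + h]\<close> contains one of
  the at most two preimages of \<open>t\<close>, so \<open>s\<close> ranges over a set of measure at most \<open>2h\<close>. The level
  \<open>g 0\<close> is exempt because \<open>g\<close> will be a closed curve extended by constants.\<close>

lemma nn_integral_increment_le:
  fixes g :: "real \<Rightarrow> real"
  assumes g: "continuous_on UNIV g" and J: "J \<in> sets borel" and h: "0 \<le> h"
    and two: "\<And>t. t \<in> J \<Longrightarrow> t \<noteq> g 0 \<Longrightarrow> \<exists>v w. \<forall>r. g r = t \<longrightarrow> r = v \<or> r = w"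
    and btw: "\<And>x y t. g x < t \<Longrightarrow> t < g y \<Longrightarrow> t \<in> J"
  shows "(\<integral>\<^sup>+s. ennreal \<bar>g (s + h) - g s\<bar> \<partial>lborel) \<le> ennreal (2 * h) * emeasure lborel J"
proof -
  \<comment> \<open>The negative product says that \<open>t\<close> lies strictly between the two
    values in either order; integrating over \<open>t\<close> therefore gives the absolute
    increment.\<close>
  define E where "E s t = (indicator {t. (g s - t) * (g (s + h) - t) < 0} t :: ennreal)" for s t
  have [measurable]: "g \<in> borel_measurable borel" using g by (rule borel_measurable_continuous_onI)
  note [measurable] = J
  have Em: "case_prod E \<in> borel_measurable (lborel \<Otimes>\<^sub>M lborel)"
    unfolding E_def case_prod_beta by (simp add: indicator_def) 
  have inner_t: "(\<integral>\<^sup>+t. E s t \<partial>lborel) = ennreal \<bar>g (s + h) - g s\<bar>" for s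
  proof -
    have "{t. (g s - t) * (g (s + h) - t) < 0} = {min (g s) (g (s + h))<..<max (g s) (g (s + h))}"
      by (auto simp: mult_less_0_iff min_def max_def)
    moreover have "emeasure lborel {min x y<..<max x y} = ennreal \<bar>y - x\<bar>" for x y :: real
      by (auto simp: min_def max_def)
    ultimately show ?thesis unfolding E_def by simp
  qed
  have inner_s: "(\<integral>\<^sup>+s. E s t \<partial>lborel) \<le> ennreal (2 * h) * indicator J t" if t: "t \<noteq> g 0" for t
  proof -
    have ex: "\<exists>r\<in>{s..s+h}. g r = t" if "(g s - t) * (g (s + h) - t) < 0" for s
    proof -
      have c: "continuous_on {s..s+h} g" using g continuous_on_subset by blast
      from that consider "g s < t" "t < g (s + h)" | "t < g s" "g (s + h) < t"
        by (auto simp: mult_less_0_iff)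
      then show ?thesis
        using IVT'[of g s t "s + h"] IVT2'[of g "s + h" t s] c h by cases force+
    qed
    show ?thesis
    proof (cases "t \<in> J")
      case True
      then obtain v w where vw: "\<And>r. g r = t \<Longrightarrow> r = v \<or> r = w" using two t by blast
      have "(\<integral>\<^sup>+s. E s t \<partial>lborel) \<le> (\<integral>\<^sup>+s. indicator ({v-h..v} \<union> {w-h..w}) s \<partial>lborel)"
      proof (rule nn_integral_mono)
        fix s
        have "s \<in> {v-h..v} \<union> {w-h..w}" if "(g s - t) * (g (s + h) - t) < 0"
          using ex[OF that] vw by fastforce
        then show "E s t \<le> indicator ({v-h..v} \<union> {w-h..w}) s" by (auto simp: E_def indicator_def)
      qed
      also have "\<dots> = emeasure lborel ({v-h..v} \<union> {w-h..w})" by (rule nn_integral_indicator) simp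
      also have "\<dots> \<le> emeasure lborel {v-h..v} + emeasure lborel {w-h..w}"
        by (rule emeasure_subadditive) auto
      also have "\<dots> = ennreal (2 * h)" using h by (simp flip: ennreal_plus)
      finally show ?thesis using True by simp
    next
      case False
      have "E s t = 0" for s
        using False btw[of s t "s + h"] btw[of "s + h" t s] by (auto simp: E_def indicator_def mult_less_0_iff)
      then show ?thesis by simp
    qed
  qed
  have "(\<integral>\<^sup>+s. ennreal \<bar>g (s + h) - g s\<bar> \<partial>lborel) = (\<integral>\<^sup>+s. \<integral>\<^sup>+t. E s t \<partial>lborel \<partial>lborel)"
    by (simp add: inner_t)
  also have "\<dots> = (\<integral>\<^sup>+t. \<integral>\<^sup>+s. E s t \<partial>lborel \<partial>lborel)"
    by (rule lborel_pair.Fubini'[OF Em, symmetric])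
  also have "\<dots> \<le> (\<integral>\<^sup>+t. ennreal (2 * h) * indicator J t \<partial>lborel)"
  proof (rule nn_integral_mono_AE)
    have "AE t in lborel. t \<noteq> g 0" by (rule AE_lborel_singleton)
    then show "AE t in lborel. (\<integral>\<^sup>+s. E s t \<partial>lborel) \<le> ennreal (2 * h) * indicator J t"
      by eventually_elim (rule inner_s)
  qed
  also have "\<dots> = ennreal (2 * h) * emeasure lborel J" by (rule nn_integral_cmult_indicator) simp
  finally show ?thesis .
qed

text \<open>The absolute difference quotients with step \<open>k n\<close> have integral at most
  \<open>2 * emeasure lborel J\<close> by the increment bound, and Fatou's lemma carries this to
  their limit \<open>\<bar>D s\<bar>\<close>.\<close>

lemma nn_integral_abs_deriv_le:
  fixes g :: "real \<Rightarrow> real"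
  assumes g: "continuous_on UNIV g" and J: "J \<in> sets borel"
    and two: "\<And>t. t \<in> J \<Longrightarrow> t \<noteq> g 0 \<Longrightarrow> \<exists>v w. \<forall>r. g r = t \<longrightarrow> r = v \<or> r = w"
    and btw: "\<And>x y t. g x < t \<Longrightarrow> t < g y \<Longrightarrow> t \<in> J"
    and deriv: "AE s in lebesgue_on S. (g has_real_derivative D s) (at s)"
    and S: "S \<in> sets borel"
  shows "(\<integral>\<^sup>+s. ennreal \<bar>D s\<bar> \<partial>lebesgue_on S) \<le> 2 * emeasure lborel J"
proof -
  define k where "k n = inverse (real (Suc n))" for n
  have k0: "0 < k n" for n by (simp add: k_def)
  define u where "u n s = ennreal (\<bar>g (s + k n) - g s\<bar> / k n)" for n s
  have gm [measurable]: "g \<in> borel_measurable borel" using g by (rule borel_measurable_continuous_onI)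
  have um [measurable]: "u n \<in> borel_measurable lborel" for n unfolding u_def by measurable
  have ub: "(\<integral>\<^sup>+s. u n s \<partial>lborel) \<le> 2 * emeasure lborel J" for n
  proof -
    have "(\<integral>\<^sup>+s. u n s \<partial>lborel) = (\<integral>\<^sup>+s. ennreal (1 / k n) * ennreal \<bar>g (s + k n) - g s\<bar> \<partial>lborel)"
      using k0[of n] by (intro nn_integral_cong) (simp add: u_def flip: ennreal_mult)
    also have "\<dots> = ennreal (1 / k n) * (\<integral>\<^sup>+s. ennreal \<bar>g (s + k n) - g s\<bar> \<partial>lborel)"
      by (rule nn_integral_cmult) measurable
    also have "\<dots> \<le> ennreal (1 / k n) * (ennreal (2 * k n) * emeasure lborel J)"
      using k0[of n] by (intro mult_left_mono nn_integral_increment_le[OF g J _ two btw]) auto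
    also have "\<dots> = ennreal (1 / k n * (2 * k n)) * emeasure lborel J"
      using k0[of n] by (subst ennreal_mult) (auto simp: mult.assoc)
    also have "1 / k n * (2 * k n) = 2" using k0[of n] by simp
    finally show ?thesis by simp
  qed
  have lim: "(\<lambda>n. u n s) \<longlonglongrightarrow> ennreal \<bar>D s\<bar>" if "(g has_real_derivative D s) (at s)" for s
  proof -
    have "(\<lambda>h. (g (s + h) - g s) / h) \<midarrow>0\<rightarrow> D s" using that by (simp add: DERIV_def)
    moreover have "k \<longlonglongrightarrow> 0" unfolding k_def by (rule LIMSEQ_inverse_real_of_nat)
    then have "filterlim k (at 0) sequentially"
      using k0 by (auto simp: filterlim_at less_imp_neq[THEN not_sym])
    ultimately have "(\<lambda>n. (g (s + k n) - g s) / k n) \<longlonglongrightarrow> D s" by (rule filterlim_compose)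
    then have "(\<lambda>n. ennreal \<bar>(g (s + k n) - g s) / k n\<bar>) \<longlonglongrightarrow> ennreal \<bar>D s\<bar>"
      by (intro tendsto_ennrealI tendsto_rabs)
    then show ?thesis using k0 by (simp add: u_def abs_divide abs_of_pos)
  qed
  have "(\<integral>\<^sup>+s. ennreal \<bar>D s\<bar> \<partial>lebesgue_on S) = (\<integral>\<^sup>+s. liminf (\<lambda>n. u n s) \<partial>lebesgue_on S)"
    using deriv
  proof (intro nn_integral_cong_AE, eventually_elim)
    case (elim s)
    then show ?case using lim_imp_Liminf[OF _ lim[of s]] by simp
  qed
  also have "\<dots> = (\<integral>\<^sup>+s. liminf (\<lambda>n. u n s) * indicator S s \<partial>lborel)"
    using S by (simp add: nn_integral_restrict_space nn_integral_completion)
  also have "\<dots> \<le> (\<integral>\<^sup>+s. liminf (\<lambda>n. u n s) \<partial>lborel)"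
    by (intro nn_integral_mono) (auto simp: indicator_def)
  also have "\<dots> \<le> liminf (\<lambda>n. \<integral>\<^sup>+s. u n s \<partial>lborel)"
    by (rule nn_integral_liminf) (rule um)
  also have "\<dots> \<le> 2 * emeasure lborel J"
    by (rule Liminf_le) (use ub in auto)
  finally show ?thesis .
qed

text \<open>The projected boundary curve takes almost every level of the projected interior at most
  twice, so its total variation is at most twice the length of that projection.\<close>

lemma nn_integral_boundary_normal_le:
  fixes \<gamma> :: "real \<Rightarrow> real^2" and n :: "real^2"
  assumes conv: "convex \<Omega>" and int: "interior \<Omega> \<noteq> {}"
    and arc: "arclength_boundary \<Omega> \<gamma>" and n: "n \<noteq> 0"
  shows "(\<integral>\<^sup>+s. ennreal \<bar>n \<bullet> vector_derivative \<gamma> (at s)\<bar> \<partial>lebesgue_on {0..boundary_length \<Omega>})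
    \<le> 2 * emeasure lborel ((\<lambda>x. n \<bullet> x) ` interior \<Omega>)"
proof -
  define P where "P = boundary_length \<Omega>"
  define J where "J = (\<lambda>x. n \<bullet> x) ` interior \<Omega>"
  have im: "\<gamma> ` {0..P} = frontier \<Omega>" and closed: "\<gamma> 0 = \<gamma> P" and inj: "inj_on \<gamma> {0..<P}"
    and lip: "1-lipschitz_on {0..P} \<gamma>"
    and diff: "AE s in lebesgue_on {0..P}. \<gamma> differentiable (at s)"
    using arc unfolding arclength_boundary_def P_def Let_def by auto
  have P0: "0 \<le> P" by (simp add: P_def boundary_length_def)
  \<comment> \<open>Clamping to \<open>[0, P]\<close> extends the projected curve by constants to
    the whole line.\<close>
  define c where "c x = max 0 (min P x)" for x :: real
  define g where "g x = n \<bullet> \<gamma> (c x)" for x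
  have c: "c x \<in> {0..P}" for x using P0 by (auto simp: c_def)
  have lin: "linear (\<lambda>x. n \<bullet> x)" by (simp add: bounded_linear.linear bounded_linear_inner_right)
  have "surj (\<lambda>x. n \<bullet> x)"
  proof (rule surjI)
    show "n \<bullet> ((y / (n \<bullet> n)) *\<^sub>R n) = y" for y using n by simp
  qed
  then have openJ: "open J" unfolding J_def by (intro open_surjective_linear_image lin) auto
  have convJ: "convex J" unfolding J_def using lin conv by (intro convex_linear_image convex_interior)
  have gJ: "g x \<in> closure J" for x
  proof -
    have "\<gamma> (c x) \<in> closure \<Omega>" using im c[of x] by (auto simp: frontier_def)
    also have "closure \<Omega> = closure (interior \<Omega>)" using convex_closure_interior[OF conv int] ..
    finally show ?thesis
      unfolding g_def J_def using closure_linear_image_subset[OF lin] by blast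
  qed
  have "(\<integral>\<^sup>+s. ennreal \<bar>n \<bullet> vector_derivative \<gamma> (at s)\<bar> \<partial>lebesgue_on {0..P}) \<le> 2 * emeasure lborel J"
  proof (rule nn_integral_abs_deriv_le)
    show "continuous_on UNIV g"
      unfolding g_def by (intro continuous_intros continuous_on_compose2[OF lipschitz_on_continuous_on[OF lip]])
        (use c in \<open>auto simp: c_def intro!: continuous_intros\<close>)
    show "J \<in> sets borel" using openJ by simp
  next
    fix t assume t: "t \<in> J" "t \<noteq> g 0"
    obtain y z where yz: "\<And>x. x \<in> frontier \<Omega> \<Longrightarrow> n \<bullet> x = t \<Longrightarrow> x = y \<or> x = z"
      using convex_frontier_level_two_points[OF conv n] t(1) unfolding J_def by metis
    \<comment> \<open>Injectivity on \<open>[0, P)\<close> is used only on the open interval; the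
      base point is dealt with by \<open>t \<noteq> g 0\<close>.\<close>
    have uniq: "\<exists>v. \<forall>r\<in>{0<..<P}. \<gamma> r = x \<longrightarrow> r = v" for x
      by (metis (no_types, lifting) inj inj_onD atLeastLessThan_iff greaterThanLessThan_iff less_imp_le)
    obtain v w where v: "\<forall>r\<in>{0<..<P}. \<gamma> r = y \<longrightarrow> r = v" and w: "\<forall>r\<in>{0<..<P}. \<gamma> r = z \<longrightarrow> r = w"
      using uniq by metis
    have "r = v \<or> r = w" if r: "g r = t" for r
    proof -
      \<comment> \<open>Outside \<open>(0, P)\<close> the extension is constantly
        \<open>g 0\<close>, on the right because the curve is closed.\<close>
      have "\<not> r \<le> 0" using r t(2) P0 by (auto simp: g_def c_def)
      moreover have "\<not> P \<le> r" using r t(2) P0 closed by (auto simp: g_def c_def)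
      ultimately have rP: "r \<in> {0<..<P}" "c r = r" by (auto simp: c_def)
      then have "\<gamma> r \<in> frontier \<Omega>" using im by auto
      then show ?thesis using yz[of "\<gamma> r"] r rP v w by (auto simp: g_def)
    qed
    then show "\<exists>v w. \<forall>r. g r = t \<longrightarrow> r = v \<or> r = w" by blast
  next
    fix x y t assume t: "g x < t" "t < g y"
    \<comment> \<open>The values of \<open>g\<close> lie in the closure of \<open>J\<close>,
      possibly at its ends. A level strictly between two of them is interior to the closure, and an
      open convex set is the interior of its closure.\<close>
    have "convex (closure J)" by (rule convex_closure[OF convJ])
    then have "{g x<..<g y} \<subseteq> closure J"
      using gJ[of x] gJ[of y] mem_is_interval_1_I[of "closure J" "g x" "g y"]
      by (auto simp: is_interval_convex_1)
    then have "{g x<..<g y} \<subseteq> interior (closure J)" by (intro interior_maximal) auto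
    also have "\<dots> = J" using convJ openJ by (simp add: convex_interior_closure interior_open)
    finally show "t \<in> J" using t by auto
  next
    \<comment> \<open>The two endpoints are discarded, since \<open>g\<close> agrees with the
      projected curve near \<open>s\<close> only for \<open>s\<close> in
      \<open>(0, P)\<close>.\<close>
    have ae: "AE s in lebesgue_on {0..P}. s \<noteq> r" for r
      by (subst AE_restrict_space_iff) (auto intro: AE_completion eventually_mono[OF AE_completion[OF AE_lborel_singleton]])
    have "AE s in lebesgue_on {0..P}. s \<in> {0..P}" by (subst AE_restrict_space_iff) auto
    with diff ae[of 0] ae[of P]
    show "AE s in lebesgue_on {0..P}. (g has_real_derivative n \<bullet> vector_derivative \<gamma> (at s)) (at s)"
    proof eventually_elim
      case (elim s)
      have "((\<lambda>x. n \<bullet> \<gamma> x) has_vector_derivative n \<bullet> vector_derivative \<gamma> (at s)) (at s)"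
        using elim by (intro bounded_linear.has_vector_derivative[OF bounded_linear_inner_right])
          (simp add: vector_derivative_works)
      then show ?case
        unfolding has_real_derivative_iff_has_vector_derivative
        by (rule has_vector_derivative_transform_within_open[where S = "{0<..<P}"])
          (use elim in \<open>auto simp: g_def c_def\<close>)
    qed
  qed simp
  then show ?thesis by (simp add: P_def J_def)
qed

section \<open>Orientation measures\<close>

context
  fixes W :: "'i measure" and \<tau> :: "'i \<Rightarrow> real"
  assumes W: "finite_measure W" and \<tau>: "\<tau> \<in> borel_measurable W"
begin

lemma finite_measure_symm_angular: "finite_measure (symm_angular W \<tau>)"
proof -
  have "finite_measure (W \<Otimes>\<^sub>M count_space {0, pi})"
    by (intro finite_measure_pair_measure W finite_measure_count_space) simp
  then show ?thesis
    unfolding symm_angular_def by (rule finite_measure.finite_measure_distr[OF _ measurable_symm_angular[OF \<tau>]])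
qed

lemma borel_measurable_id_symm_angular: "(\<lambda>x. x) \<in> borel_measurable (symm_angular W \<tau>)"
proof -
  have "(\<lambda>x. x) \<in> borel_measurable circle_borel"
    unfolding circle_borel_def by (rule measurable_restrict_space1) simp
  then show ?thesis by (simp add: symm_angular_def)
qed

lemma measure_space_symm_angular:
  "measure (symm_angular W \<tau>) (space (symm_angular W \<tau>)) = 2 * measure W (space W)"
  using integral_symm_angular[OF \<tau> W, of "\<lambda>_. 1 :: real"] by simp

lemma sine_transform_symm_angular:
  "sine_transform (symm_angular W \<tau>) t = 2 * (\<integral>x. \<bar>sin (t - \<tau> x)\<bar> \<partial>W)"
proof -
  have s: "\<bar>sin (t - (x + pi))\<bar> = \<bar>sin (t - x)\<bar>" for x
    using sin_minus_pi[of "t - x"] by (simp add: algebra_simps)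
  have "\<bar>sin (t - (x + 2 * pi))\<bar> = \<bar>sin (t - x)\<bar>" for x
    using s[of "x + pi"] s[of x] by (simp add: algebra_simps)
  then have "sine_transform (symm_angular W \<tau>) t = (\<integral>x. \<bar>sin (t - \<tau> x)\<bar> + \<bar>sin (t - (\<tau> x + pi))\<bar> \<partial>W)"
    unfolding sine_transform_def by (intro integral_symm_angular \<tau> W continuous_intros)
  then show ?thesis by (simp only: s mult_2[symmetric] integral_mult_right_zero)
qed

text \<open>An odd character changes sign under rotation by \<pi>, so the contributions of
  \<open>\<tau> x\<close> and \<open>\<tau> x + pi\<close> cancel.\<close>

lemma fourier_coeff_symm_angular_odd:
  assumes "odd l"
  shows "fourier_coeff (symm_angular W \<tau>) l = 0"
proof -
  have l: "exp (- \<i> * of_int l * of_real (x + pi)) = - exp (- \<i> * of_int l * of_real x)" for x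
  proof -
    obtain k where k: "l = 2 * k + 1" using assms by (auto elim: oddE)
    have "- \<i> * of_int l * of_real (x + pi) =
        - \<i> * of_int l * of_real x + (2 * of_int (- k) * of_real pi * \<i> + - (of_real pi * \<i>))"
      by (simp add: k algebra_simps)
    then have "exp (- \<i> * of_int l * of_real (x + pi)) =
        exp (- \<i> * of_int l * of_real x) * (exp (2 * of_int (- k) * of_real pi * \<i>) * exp (- (of_real pi * \<i>)))"
      by (simp only: exp_add)
    also have "exp (2 * of_int (- k) * of_real pi * \<i>) = 1" using exp_integer_2pi[of "of_int (- k)"] by simp
    also have "exp (- (of_real pi * \<i>)) = -1" by (simp add: exp_minus)
    finally show ?thesis by simp
  qed
  have "exp (- \<i> * of_int l * of_real (x + 2 * pi)) = exp (- \<i> * of_int l * of_real x)" for x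
    using l[of "x + pi"] l[of x] by (simp add: algebra_simps)
  then have "(\<integral>x. exp (- \<i> * of_int l * of_real x) \<partial>symm_angular W \<tau>) =
      (\<integral>x. exp (- \<i> * of_int l * of_real (\<tau> x)) + exp (- \<i> * of_int l * of_real (\<tau> x + pi)) \<partial>W)"
    by (intro integral_symm_angular \<tau> W continuous_intros)
  also have "\<dots> = 0" by (simp only: l) simp
  finally show ?thesis by (simp add: fourier_coeff_def)
qed

text \<open>The comparison of the two transforms passes through Lebesgue measures of projections,
  hence this version in \<open>ennreal\<close>.\<close>

lemma ennreal_sine_transform_symm_angular:
  "ennreal (sine_transform (symm_angular W \<tau>) t) = 2 * (\<integral>\<^sup>+x. ennreal \<bar>sin (t - \<tau> x)\<bar> \<partial>W)"
proof -
  note [measurable] = \<tau>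
  have "integrable W (\<lambda>x. \<bar>sin (t - \<tau> x)\<bar>)"
    by (rule finite_measure.integrable_const_bound[OF W, where B = 1]) auto
  then show ?thesis
    by (simp add: sine_transform_symm_angular nn_integral_eq_integral ennreal_mult)
qed

end

section \<open>Masses and comparison of the two orientation measures\<close>

definition segment_weight :: "nat set \<Rightarrow> (nat \<Rightarrow> real^2) \<Rightarrow> (nat \<Rightarrow> real^2) \<Rightarrow> nat measure" where
  "segment_weight I a b = density (count_space I) (\<lambda>i. ennreal (dist (a i) (b i) / 2))"

lemma segment_weight:
  assumes "(\<lambda>i. dist (a i) (b i)) summable_on I"
  shows "finite_measure (segment_weight I a b)"
    and "2 * measure (segment_weight I a b) (space (segment_weight I a b)) = total_length I a b"
proof -
  \<comment> \<open>The two library notions of absolute summability lead from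
    \<open>summable_on\<close> to integrability for the counting measure.\<close>
  have "Infinite_Sum.abs_summable_on (\<lambda>i. dist (a i) (b i)) I" using assms by simp
  then have abs: "Infinite_Set_Sum.abs_summable_on (\<lambda>i. dist (a i) (b i)) I"
    by (simp only: abs_summable_equivalent)
  then have int: "integrable (count_space I) (\<lambda>i. dist (a i) (b i) / 2)"
    by (simp add: abs_summable_on_def)
  have em: "emeasure (segment_weight I a b) (space (segment_weight I a b)) =
      ennreal (total_length I a b / 2)"
  proof -
    have "emeasure (segment_weight I a b) (space (segment_weight I a b)) =
        (\<integral>\<^sup>+i. ennreal (dist (a i) (b i) / 2) \<partial>count_space I)"
      unfolding segment_weight_def by (subst emeasure_density) (auto intro!: nn_integral_cong)
    also have "\<dots> = ennreal (\<integral>i. dist (a i) (b i) / 2 \<partial>count_space I)"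
      by (rule nn_integral_eq_integral[OF int]) simp
    also have "(\<integral>i. dist (a i) (b i) / 2 \<partial>count_space I) = total_length I a b / 2"
      using infsetsum_infsum[OF abs] by (simp add: total_length_def infsetsum_def)
    finally show ?thesis .
  qed
  then show "finite_measure (segment_weight I a b)" by (intro finite_measureI) simp
  have "0 \<le> total_length I a b" unfolding total_length_def by (rule infsum_nonneg) simp
  then show "2 * measure (segment_weight I a b) (space (segment_weight I a b)) = total_length I a b"
    by (simp add: measure_def em)
qed

text \<open>Both transforms at \<open>t\<close> are compared with the length of the projection of
  the interior of \<Omega> onto the normal of direction \<open>t\<close>.\<close>

lemma sine_transform_boundary_le_segments:
  fixes \<Omega> \<O> :: "(real^2) set" and \<gamma> :: "real \<Rightarrow> real^2"
  assumes conv: "convex \<Omega>" and int: "interior \<Omega> \<noteq> {}"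
    and opq: "opaque_set \<O> \<Omega>" and seg: "segment_union \<O> I a b"
    and arc: "arclength_boundary \<Omega> \<gamma>"
  shows "sine_transform (boundary_orientation \<Omega> \<gamma>) t \<le> sine_transform (segments_orientation I a b) t"
proof -
  define n :: "real^2" where "n = vector [- sin t, cos t]"
  define P where "P = boundary_length \<Omega>"
  define W where "W = density (lebesgue_on {0..P}) (\<lambda>_. ennreal (1/4))"
  define J where "J = (\<lambda>x. n \<bullet> x) ` interior \<Omega>"
  have n: "n \<noteq> 0"
  proof
    assume "n = 0"
    then have "n $ 1 = 0" "n $ 2 = 0" by auto
    then show False using sin_cos_squared_add[of t] by (simp add: n_def)
  qed
  have fW: "finite_measure W"
  proof (rule finite_measureI)
    show "emeasure W (space W) \<noteq> \<infinity>"
      by (simp add: W_def emeasure_density_const emeasure_restrict_space space_restrict_space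
          ennreal_mult_eq_top_iff emeasure_lborel_Icc_eq)
  qed
  have tau: "tangent_angle \<gamma> \<in> borel_measurable W"
    using measurable_tangent_angle[OF arc] by (simp add: W_def P_def)
  have unit: "AE s in lebesgue_on {0..P}. norm (vector_derivative \<gamma> (at s)) = 1"
    using arc unfolding arclength_boundary_def P_def Let_def by auto
  note [measurable] = measurable_tangent_angle[OF arc, folded P_def]
  have "ennreal (sine_transform (boundary_orientation \<Omega> \<gamma>) t) =
      2 * (\<integral>\<^sup>+s. ennreal \<bar>sin (t - tangent_angle \<gamma> s)\<bar> \<partial>W)"
    using ennreal_sine_transform_symm_angular[OF fW tau]
    by (simp add: boundary_orientation_def W_def P_def)
  also have "(\<integral>\<^sup>+s. ennreal \<bar>sin (t - tangent_angle \<gamma> s)\<bar> \<partial>W) =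
      ennreal (1/4) * (\<integral>\<^sup>+s. ennreal \<bar>sin (t - tangent_angle \<gamma> s)\<bar> \<partial>lebesgue_on {0..P})"
    unfolding W_def by (subst nn_integral_density, measurable, rule nn_integral_cmult) measurable
  also have "(\<integral>\<^sup>+s. ennreal \<bar>sin (t - tangent_angle \<gamma> s)\<bar> \<partial>lebesgue_on {0..P}) =
      (\<integral>\<^sup>+s. ennreal \<bar>n \<bullet> vector_derivative \<gamma> (at s)\<bar> \<partial>lebesgue_on {0..P})"
    using unit
  proof (intro nn_integral_cong_AE, eventually_elim)
    case (elim s)
    then show ?case by (simp add: n_def abs_inner_normal_eq_sin tangent_angle_def)
  qed
  also have "2 * (ennreal (1/4) * \<dots>) \<le> 2 * (ennreal (1/4) * (2 * emeasure lborel J))"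
    unfolding P_def J_def
    by (intro mult_left_mono nn_integral_boundary_normal_le[OF conv int arc n]) auto
  \<comment> \<open>The factors are 2 from the symmetrization, 1/4 from the weight of the boundary
    measure and 2 from the two crossings of each level; their product is 1.\<close>
  also have "\<dots> = ennreal (2 * (1/4) * 2) * emeasure lborel J"
    by (simp only: ennreal_mult ennreal_numeral) (simp add: ac_simps ennreal_mult)
  also have "\<dots> = emeasure lborel J" by simp
  also have "\<dots> \<le> (\<integral>\<^sup>+i. ennreal \<bar>n \<bullet> (b i - a i)\<bar> \<partial>count_space I)"
    unfolding J_def by (rule emeasure_projection_le_segments[OF opq seg n interior_subset])
  also have "\<dots> = ennreal (sine_transform (segments_orientation I a b) t)"
  proof -
    have "(\<lambda>i. dist (a i) (b i)) summable_on I" using seg by (simp add: segment_union_def)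
    note f = segment_weight(1)[OF this]
    have "ennreal (sine_transform (segments_orientation I a b) t) =
        2 * (\<integral>\<^sup>+i. ennreal \<bar>sin (t - angle_of (b i - a i))\<bar> \<partial>segment_weight I a b)"
      unfolding segments_orientation_def segment_weight_def[symmetric]
      by (rule ennreal_sine_transform_symm_angular[OF f]) (simp add: segment_weight_def)
    also have "\<dots> = (\<integral>\<^sup>+i. 2 * (ennreal (dist (a i) (b i) / 2) * ennreal \<bar>sin (t - angle_of (b i - a i))\<bar>)
        \<partial>count_space I)"
      unfolding segment_weight_def by (subst nn_integral_density) (auto simp: nn_integral_cmult)
    also have "\<dots> = (\<integral>\<^sup>+i. ennreal \<bar>n \<bullet> (b i - a i)\<bar> \<partial>count_space I)"
    proof (rule nn_integral_cong)
      fix i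
      have "2 * (ennreal (dist (a i) (b i) / 2) * ennreal \<bar>sin (t - angle_of (b i - a i))\<bar>)
          = ennreal (2 * (dist (a i) (b i) / 2 * \<bar>sin (t - angle_of (b i - a i))\<bar>))"
        by (simp only: ennreal_mult ennreal_numeral zero_le_dist abs_ge_zero mult_nonneg_nonneg
            divide_nonneg_nonneg zero_le_numeral)
      then show "2 * (ennreal (dist (a i) (b i) / 2) * ennreal \<bar>sin (t - angle_of (b i - a i))\<bar>)
          = ennreal \<bar>n \<bullet> (b i - a i)\<bar>"
        by (simp add: n_def abs_inner_normal_eq_sin dist_norm norm_minus_commute)
    qed
    finally show ?thesis ..
  qed
  finally show ?thesis by (simp add: ennreal_le_iff sine_transform_nonneg)
qed

theorem mainTheorem1:
  fixes \<Omega> \<O> :: "(real^2) set" and I :: "nat set"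
    and a b :: "nat \<Rightarrow> real^2" and \<gamma> :: "real \<Rightarrow> real^2" and L :: real
  assumes "convex \<Omega>" and "bounded \<Omega>" and "interior \<Omega> \<noteq> {}"
    and "opaque_set \<O> \<Omega>"
    and "segment_union \<O> I a b"
    and "L = total_length I a b"
    and "arclength_boundary \<Omega> \<gamma>"
  shows "Hdot_minus2_norm_diff (segments_orientation I a b) (boundary_orientation \<Omega> \<gamma>)
    \<le> L powr (1/4) / sqrt 2 * (L - boundary_length \<Omega> / 2) powr (3/4)"
proof -
  define P where "P = boundary_length \<Omega>"
  have P0: "0 \<le> P" by (simp add: P_def boundary_length_def)
  define V where "V = density (lebesgue_on {0..P}) (\<lambda>_. ennreal (1/4))"
  define W where "W = segment_weight I a b"
  have emV: "emeasure V (space V) = ennreal (P / 4)"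
    using P0 by (simp add: V_def emeasure_density_const emeasure_restrict_space space_restrict_space
        flip: ennreal_mult)
  have V: "finite_measure V" by (rule finite_measureI) (simp add: emV)
  have mV: "2 * measure V (space V) = P / 2" using P0 by (simp add: measure_def emV)
  have \<tau>V: "tangent_angle \<gamma> \<in> borel_measurable V"
    using measurable_tangent_angle[OF assms(7)] by (simp add: V_def P_def)
  have sum: "(\<lambda>i. dist (a i) (b i)) summable_on I" using assms(5) by (simp add: segment_union_def)
  have W: "finite_measure W" and mW: "2 * measure W (space W) = L"
    using segment_weight[OF sum] assms(6) by (simp_all add: W_def)
  have \<tau>W: "(\<lambda>i. angle_of (b i - a i)) \<in> borel_measurable W" by (simp add: W_def segment_weight_def)
  have bd: "boundary_orientation \<Omega> \<gamma> = symm_angular V (tangent_angle \<gamma>)"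
    by (simp add: boundary_orientation_def V_def P_def)
  have sg: "segments_orientation I a b = symm_angular W (\<lambda>i. angle_of (b i - a i))"
    by (simp add: segments_orientation_def W_def segment_weight_def)
  note le = sine_transform_boundary_le_segments[OF assms(1,3,4,5,7)]
  \<comment> \<open>Symmetrization doubles the masses of the weights, so the general estimate is
    applied with total masses \<open>L\<close> and \<open>P / 2\<close>.\<close>
  show ?thesis
    using Hdot_minus2_norm_diff_le_of_sine_transform_le[OF
        finite_measure_symm_angular[OF W \<tau>W] borel_measurable_id_symm_angular[OF W \<tau>W]
        finite_measure_symm_angular[OF V \<tau>V] borel_measurable_id_symm_angular[OF V \<tau>V]
        le[unfolded bd sg] fourier_coeff_symm_angular_odd[OF W \<tau>W] fourier_coeff_symm_angular_odd[OF V \<tau>V]]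
    unfolding measure_space_symm_angular[OF W \<tau>W] measure_space_symm_angular[OF V \<tau>V] mV mW bd sg P_def .
qed

end
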